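(* Let $g\colon U\to V$ be a morphism of associative algebras over a field of characteristic $0$ and $T=U\oplus V$. For $\theta\in C^{n-1}_{\mathbf{As}_{B\to W}}(T;T)$, corresponding to $(\theta_U,\theta_V,\theta_g)\in C^n_{GS}(g;g)$, we have $$\delta_{GS}(\theta_U,\theta_V,\theta_g)=\big((-1)^{n+1}b\theta_U,\ (-1)^{n+1}b\theta_V,\ g\theta_U-\theta_Vg^{\otimes n}-(-1)^nb\theta_g\big),$$ where $b$ denotes the appropriate Hochschild differential and $\delta_{GS}$ is the differential induced by $\delta_{\mathbf{As}_{B\to W}}$. In particular, there is a cochain complex isomorphism $$\big(C^{*-1}_{\mathbf{As}_{B\to W}}(T;T),\delta_{\mathbf{As}_{B\to W}}\big)\cong\big(C^*_{GS}(g;g),d_{GS}\big)$$ given by $$\theta\in C^{n-1}_{\mathbf{As}_{B\to W}}(T;T)\ \mapsto\ \Big((-1)^{\frac{n(n+1)}2}\theta_U,\ (-1)^{\frac{n(n+1)}2}\theta_V,\ (-1)^{\frac{(n-1)n}2}\theta_g\Big).$$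
   Context: $\mathbf k$ is a field of characteristic $0$; $(U,\mu_U)$, $(V,\mu_V)$ are associative $\mathbf k$-algebras and $g\colon U\to V$ an algebra morphism. $T=U\oplus V$ is two-colored with $T_B=U$, $T_W=V$, and $\mathrm{End}_T$ is its 2-colored endomorphism PROP, consisting of the spaces $\mathrm{Hom}_{\mathbf k}(T_{c_1}\otimes\cdots\otimes T_{c_n},T_{d_1}\otimes\cdots\otimes T_{d_m})$, $c_i,d_j\in\{B,W\}$. **Minimal model.** $\mathbf{As}_{B\to W}$ is the 2-colored operad whose algebras are morphisms of associative algebras. Its minimal model is $(\mathsf F(E),\partial)$, where $\mathsf F(E)$ is the free 2-colored PROP on the 2-colored $\Sigma$-bimodule $E$ with generators $\mu_n\colon B^{\otimes n}\to B$ of degree $n-2$ ($n\ge2$), $\nu_n\colon W^{\otimes n}\to W$ of degree $n-2$ ($n\ge2$), $f_n\colon B^{\otimes n}\to W$ of degree $n-1$ ($n\ge1$), and $$\partial(\mu_n)=\sum_{\substack{i+j=n+1\\ i,j\ge2}}\sum_{s=0}^{n-j}(-1)^{i+s(j+1)}\mu_i\circ_{s+1}\mu_j,\qquad \partial(\nu_n)=\sum_{\substack{i+j=n+1\\ i,j\ge2}}\sum_{s=0}^{n-j}(-1)^{i+s(j+1)}\nu_i\circ_{s+1}\nu_j,$$ $$\partial(f_n)=-\sum_{l=2}^n\sum_{r_1+\cdots+r_l=n}(-1)^{\sum_{1\le i<j\le l}r_i(r_j+1)}\nu_l(f_{r_1}\otimes\cdots\otimes f_{r_l})-\sum_{\substack{i+j=n+1\\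 i\ge1,j\ge2}}\sum_{s=0}^{n-j}(-1)^{i+s(j+1)}f_i\circ_{s+1}\mu_j,$$ where $x\circ_{s+1}y$ plugs $y$ into the $(s+1)$st input of $x$. The morphism $g$ corresponds to $\beta\colon\mathsf F(E)\to\mathrm{End}_T$ with $\beta(\mu_2)=\mu_U$, $\beta(\nu_2)=\mu_V$, $\beta(f_1)=g$, and $\beta=0$ on all other generators $\mu_n,\nu_n,f_n$. **Deformation complex.** $C^*_{\mathbf{As}_{B\to W}}(T;T)=\,\uparrow\mathrm{Der}(\mathsf F(E),\mathrm{End}_T)^{-*}\cong\,\uparrow\mathrm{Hom}_\Sigma(E,\mathrm{End}_T)^{-*}$ (derivations with respect to the $\mathsf F(E)$-module structure on $\mathrm{End}_T$ via $\beta$; $\uparrow$ suspension, $-*$ reversed grading). Thus $\theta\in C^{n}$ is a color-preserving equivariant linear map $E\to\mathrm{End}_T$ supported on generators of degree $n-1$, extended to a derivation of $\mathsf F(E)$. The differential $\delta_{\mathbf{As}_{B\to W}}=l_1$ is induced by $\theta\mapsto\theta\partial$, explicitly: $l_1(\theta)(\xi)$ for a generator $\xi$ is the sum, over all terms of $\partial(\xi)$ and all vertices $v$ of that term, of the composite in $\mathrm{End}_T$ obtained by applying $\theta$ to the decoration of $v$ and $\beta$ to the decorations of the other vertices (no signs other than the coefficients in $\partial(\xi)$). An element $\theta\in C^{n}_{\mathbf{As}_{B\to W}}(T;T)$ is identified with the tuple $$(\theta_U,\theta_V,\theta_g):=(\theta(\mu_{n+1}),\theta(\nu_{n+1}),\theta(f_n))\in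 C^{n+1}_{GS}(g;g);$$ this is the linear isomorphism $C^n_{\mathbf{As}_{B\to W}}(T;T)\cong C^{n+1}_{GS}(g;g)$ used here, and $\delta_{GS}$ denotes the differential on the graded module $C^{*}_{GS}(g;g)$ induced through it by $\delta_{\mathbf{As}_{B\to W}}$. **Gerstenhaber–Schack complex.** For $n\ge1$, $C^n_{GS}(g;g)=\mathrm{Hom}(U^{\otimes n},U)\oplus\mathrm{Hom}(V^{\otimes n},V)\oplus\mathrm{Hom}(U^{\otimes n-1},V)$, with $d_{GS}(x_U,x_V,x_g)=(bx_U,bx_V,gx_U-x_Vg^{\otimes n}-bx_g)$; $V$ is a $U$-bimodule via $g$. The Hochschild differential of $\varphi\in\mathrm{Hom}(A^{\otimes n},M)$ is $(b\varphi)(a_1,\ldots,a_{n+1})=a_1\varphi(a_2,\ldots,a_{n+1})+\sum_{i=1}^n(-1)^i\varphi(\ldots,a_ia_{i+1},\ldots)+(-1)^{n+1}\varphi(a_1,\ldots,a_n)a_{n+1}$.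
   Formalization: Bijectivity of the map is claimed only for n ≥ 2: no generator has degree −1, so C^0 of As_{B→W} is 0, while C^1_GS(g;g) = Hom(U,U)⊕Hom(V,V)⊕V is nonzero (e.g. U = V = k, g = id); the formula and cochain map are stated for all n ≥ 1. *)

theory Defs
  imports
    "HOL-Analysis.Product_Vector"
    "HOL-Library.Function_Algebras"
    "HOL-Library.Poly_Mapping"
    "HOL-Combinatorics.Permutations"
begin

section \<open>Associative algebras and multilinear maps\<close>

text \<open>Algebras are not assumed to be unital: the class \<open>ring\<close> has no unit.\<close>

locale assoc_algebra = vector_space scale
  for scale :: "'k::field \<Rightarrow> 'a::ring \<Rightarrow> 'a" +
  assumes scale_mult_left: "scale c x * y = scale c (x * y)"
    and scale_mult_right: "x * scale c y = scale c (x * y)"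

locale algebra_morphism =
  source: assoc_algebra sU + target: assoc_algebra sV + Vector_Spaces.linear sU sV g
  for sU :: "'k::field \<Rightarrow> 'u::ring \<Rightarrow> 'u" and sV :: "'k \<Rightarrow> 'v::ring \<Rightarrow> 'v" and g :: "'u \<Rightarrow> 'v" +
  assumes map_mult: "g (x * y) = g x * g y"

definition fun_scale :: "('k \<Rightarrow> 'm \<Rightarrow> 'm) \<Rightarrow> 'k \<Rightarrow> ('x \<Rightarrow> 'm) \<Rightarrow> 'x \<Rightarrow> 'm" where
  "fun_scale s c F = (\<lambda>x. s c (F x))"

text \<open>
  A linear map out of a tensor product \<open>W\<^sub>1 \<otimes> \<dots> \<otimes> W\<^sub>n\<close> of subspaces of one ambient
  space is given by the multilinear map that it represents, a function on lists. So that equality of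
  functions is equality of multilinear maps, the function is \<open>0\<close> on every list that is not in
  \<open>W\<^sub>1 \<times> \<dots> \<times> W\<^sub>n\<close>. For \<open>n = 0\<close> this is \<open>Hom(k, M) = M\<close>, by evaluation at \<open>[]\<close>.
\<close>

definition tensor_hom ::
  "('k \<Rightarrow> 'a::ab_group_add \<Rightarrow> 'a) \<Rightarrow> ('k \<Rightarrow> 'm::ab_group_add \<Rightarrow> 'm) \<Rightarrow>
   'a set list \<Rightarrow> 'm set \<Rightarrow> ('a list \<Rightarrow> 'm) set" where
  "tensor_hom sA sM Ws M = {F.
     (\<forall>xs. \<not> list_all2 (\<in>) xs Ws \<longrightarrow> F xs = 0) \<and>
     (\<forall>xs. list_all2 (\<in>) xs Ws \<longrightarrow> F xs \<in> M \<and>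
        (\<forall>i<length Ws. \<forall>x\<in>Ws ! i. \<forall>y\<in>Ws ! i. \<forall>c.
           F (xs[i := x + y]) = F (xs[i := x]) + F (xs[i := y]) \<and>
           F (xs[i := sA c x]) = sM c (F (xs[i := x]))))}"

abbreviation hom_pow ::
  "('k \<Rightarrow> 'a::ab_group_add \<Rightarrow> 'a) \<Rightarrow> ('k \<Rightarrow> 'm::ab_group_add \<Rightarrow> 'm) \<Rightarrow> nat \<Rightarrow> ('a list \<Rightarrow> 'm) set" where
  "hom_pow sA sM n \<equiv> tensor_hom sA sM (replicate n UNIV) UNIV"

section \<open>Cochain complexes\<close>

definition linear_on_set ::
  "('k \<Rightarrow> 'a::ab_group_add \<Rightarrow> 'a) \<Rightarrow> ('k \<Rightarrow> 'b::ab_group_add \<Rightarrow> 'b) \<Rightarrow> 'a set \<Rightarrow> ('a \<Rightarrow> 'b) \<Rightarrow> bool" where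
  "linear_on_set s s' C f \<longleftrightarrow>
     (\<forall>x\<in>C. \<forall>y\<in>C. f (x + y) = f x + f y) \<and> (\<forall>c. \<forall>x\<in>C. f (s c x) = s' c (f x))"

text \<open>Complexes and maps in degrees \<open>\<ge> n0\<close>; the module in degree \<open>n\<close> is the subspace \<open>C n\<close>.\<close>

definition cochain_complex ::
  "nat \<Rightarrow> ('k::field \<Rightarrow> 'a::ab_group_add \<Rightarrow> 'a) \<Rightarrow> (nat \<Rightarrow> 'a set) \<Rightarrow> (nat \<Rightarrow> 'a \<Rightarrow> 'a) \<Rightarrow> bool" where
  "cochain_complex n0 s C d \<longleftrightarrow> vector_space s \<and>
     (\<forall>n\<ge>n0. module.subspace s (C n) \<and> linear_on_set s s (C n) (d n) \<and>
        (\<forall>x\<in>C n. d n x \<in> C (Suc n) \<and> d (Suc n) (d n x) = 0))"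

definition cochain_map ::
  "nat \<Rightarrow> ('k \<Rightarrow> 'a::ab_group_add \<Rightarrow> 'a) \<Rightarrow> (nat \<Rightarrow> 'a set) \<Rightarrow> (nat \<Rightarrow> 'a \<Rightarrow> 'a) \<Rightarrow>
   ('k \<Rightarrow> 'b::ab_group_add \<Rightarrow> 'b) \<Rightarrow> (nat \<Rightarrow> 'b set) \<Rightarrow> (nat \<Rightarrow> 'b \<Rightarrow> 'b) \<Rightarrow> (nat \<Rightarrow> 'a \<Rightarrow> 'b) \<Rightarrow> bool" where
  "cochain_map n0 s C d s' C' d' \<Phi> \<longleftrightarrow>
     (\<forall>n\<ge>n0. linear_on_set s s' (C n) (\<Phi> n) \<and>
        (\<forall>x\<in>C n. \<Phi> n x \<in> C' n \<and> \<Phi> (Suc n) (d n x) = d' n (\<Phi> n x)))"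

section \<open>The endomorphism PROP of \<open>T = U \<oplus> V\<close>\<close>

datatype color = Black | White

text \<open>\<open>T\<close> is the type \<open>'u \<times> 'v\<close>; the two colors select its two summands.\<close>

definition T_part :: "color \<Rightarrow> ('u::zero \<times> 'v::zero) set" where
  "T_part c = (case c of Black \<Rightarrow> {(u, v). v = 0} | White \<Rightarrow> {(u, v). u = 0})"

definition inB :: "'u \<Rightarrow> 'u \<times> 'v::zero" where "inB u = (u, 0)"
definition inW :: "'v \<Rightarrow> 'u::zero \<times> 'v" where "inW v = (0, v)"

abbreviation T_scale ::
  "('k::field \<Rightarrow> 'u::ab_group_add \<Rightarrow> 'u) \<Rightarrow> ('k \<Rightarrow> 'v::ab_group_add \<Rightarrow> 'v) \<Rightarrow> 'k \<Rightarrow> 'u \<times> 'v \<Rightarrow> 'u \<times> 'v" where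
  "T_scale sU sV \<equiv> module_prod.scale sU sV"

type_synonym ('u, 'v) endo = "('u \<times> 'v) list \<Rightarrow> 'u \<times> 'v"

text \<open>
  Only the components of \<open>End\<^sub>T\<close> with a single output are needed, since every generator of the
  minimal model has a single output.
\<close>

definition End_T ::
  "('k::field \<Rightarrow> 'u::ab_group_add \<Rightarrow> 'u) \<Rightarrow> ('k \<Rightarrow> 'v::ab_group_add \<Rightarrow> 'v) \<Rightarrow> color list \<Rightarrow> color \<Rightarrow> ('u, 'v) endo set" where
  "End_T sU sV cs d = tensor_hom (T_scale sU sV) (T_scale sU sV) (map T_part cs) (T_part d)"

abbreviation endo_scale ::
  "('k::field \<Rightarrow> 'u::ab_group_add \<Rightarrow> 'u) \<Rightarrow> ('k \<Rightarrow> 'v::ab_group_add \<Rightarrow> 'v) \<Rightarrow> 'k \<Rightarrow>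
   ('u, 'v) endo \<Rightarrow> ('u, 'v) endo" where
  "endo_scale sU sV \<equiv> fun_scale (T_scale sU sV)"

text \<open>Right action of permutations on inputs: \<open>(F \<tau>)(x\<^sub>0, x\<^sub>1, \<dots>) = F(x\<^bsub>\<tau>\<inverse>(0)\<^esub>, x\<^bsub>\<tau>\<inverse>(1)\<^esub>, \<dots>)\<close>.\<close>

definition endo_act :: "(nat \<Rightarrow> nat) \<Rightarrow> ('u, 'v) endo \<Rightarrow> ('u, 'v) endo" where
  "endo_act \<tau> F = (\<lambda>xs. F (permute_list (inv \<tau>) xs))"

section \<open>The generating \<open>\<Sigma>\<close>-bimodule \<open>E\<close>\<close>

datatype gen = Mu nat | Nu nat | Fg nat

fun is_gen :: "gen \<Rightarrow> bool" where
  "is_gen (Mu n) \<longleftrightarrow> n \<ge> 2"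
| "is_gen (Nu n) \<longleftrightarrow> n \<ge> 2"
| "is_gen (Fg n) \<longleftrightarrow> n \<ge> 1"

fun arity :: "gen \<Rightarrow> nat" where
  "arity (Mu n) = n" | "arity (Nu n) = n" | "arity (Fg n) = n"

fun in_color :: "gen \<Rightarrow> color" where
  "in_color (Mu n) = Black" | "in_color (Nu n) = White" | "in_color (Fg n) = Black"

fun out_color :: "gen \<Rightarrow> color" where
  "out_color (Mu n) = Black" | "out_color (Nu n) = White" | "out_color (Fg n) = White"

fun gen_degree :: "gen \<Rightarrow> int" where
  "gen_degree (Mu n) = int n - 2" | "gen_degree (Nu n) = int n - 2" | "gen_degree (Fg n) = int n - 1"

text \<open>
  Each generator of arity \<open>n\<close> spans a free \<open>\<Sigma>\<^sub>n\<close>-module. The basis vector \<open>(\<xi>, \<sigma>)\<close> stands for the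
  generator \<open>\<xi>\<close> acted on from the right by \<open>\<sigma>\<close>, so \<open>E\<close> is the span of \<open>E_basis\<close> in the type
  \<open>'k bimod\<close>. All inputs of a generator have the same color, so permuting inputs preserves color
  profiles.
\<close>

type_synonym 'k bimod = "(gen \<times> (nat \<Rightarrow> nat)) \<Rightarrow>\<^sub>0 'k"

definition E_basis :: "(gen \<times> (nat \<Rightarrow> nat)) set" where
  "E_basis = {(\<xi>, \<sigma>). is_gen \<xi> \<and> \<sigma> permutes {..<arity \<xi>}}"

definition E_comp :: "color list \<Rightarrow> color \<Rightarrow> ('k::zero) bimod set" where
  "E_comp cs d = {e. Poly_Mapping.keys e \<subseteq>
     {(\<xi>, \<sigma>) \<in> E_basis. cs = replicate (arity \<xi>) (in_color \<xi>) \<and> d = out_color \<xi>}}"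

definition E_scale :: "'k::mult_zero \<Rightarrow> 'k bimod \<Rightarrow> 'k bimod" where
  "E_scale c e = Poly_Mapping.map ((*) c) e"

definition E_act :: "(nat \<Rightarrow> nat) \<Rightarrow> ('k::comm_monoid_add) bimod \<Rightarrow> 'k bimod" where
  "E_act \<tau> e = (\<Sum>(\<xi>, \<sigma>)\<in>Poly_Mapping.keys e.
     Poly_Mapping.single (\<xi>, \<sigma> \<circ> \<tau>) (Poly_Mapping.lookup e (\<xi>, \<sigma>)))"

definition gen_vec :: "gen \<Rightarrow> ('k::zero_neq_one) bimod" where
  "gen_vec \<xi> = Poly_Mapping.single (\<xi>, id) 1"

section \<open>The differential of the minimal model\<close>

text \<open>
  The elements of the free PROP that occur in \<open>\<partial>\<close> are linear combinations of planar trees with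
  vertices decorated by generators; the leaves are the inputs, in planar order.
\<close>

datatype tree = Leaf | Node gen "tree list"

definition corolla :: "gen \<Rightarrow> tree" where
  "corolla \<xi> = Node \<xi> (replicate (arity \<xi>) Leaf)"

text \<open>\<open>circ \<xi> s \<eta>\<close> is \<open>\<xi> \<circ>\<^bsub>s+1\<^esub> \<eta>\<close>.\<close>

definition circ :: "gen \<Rightarrow> nat \<Rightarrow> gen \<Rightarrow> tree" where
  "circ \<xi> s \<eta> = Node \<xi> (replicate s Leaf @ corolla \<eta> # replicate (arity \<xi> - s - 1) Leaf)"

definition compositions :: "nat \<Rightarrow> nat \<Rightarrow> nat list set" where
  "compositions l n = {rs. length rs = l \<and> sum_list rs = n \<and> (\<forall>r\<in>set rs. r \<ge> 1)}"

fun bdry :: "gen \<Rightarrow> tree \<Rightarrow>\<^sub>0 'k::comm_ring_1" where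
  "bdry (Mu n) = (\<Sum>(i, j)\<in>{(i, j). i + j = n + 1 \<and> i \<ge> 2 \<and> j \<ge> 2}. \<Sum>s=0..n - j.
     Poly_Mapping.single (circ (Mu i) s (Mu j)) ((-1) ^ (i + s * (j + 1))))"
| "bdry (Nu n) = (\<Sum>(i, j)\<in>{(i, j). i + j = n + 1 \<and> i \<ge> 2 \<and> j \<ge> 2}. \<Sum>s=0..n - j.
     Poly_Mapping.single (circ (Nu i) s (Nu j)) ((-1) ^ (i + s * (j + 1))))"
| "bdry (Fg n) =
     - (\<Sum>l=2..n. \<Sum>rs\<in>compositions l n.
         Poly_Mapping.single (Node (Nu l) (map (\<lambda>r. corolla (Fg r)) rs))
           ((-1) ^ (\<Sum>j<l. \<Sum>i<j. rs ! i * (rs ! j + 1))))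
     - (\<Sum>(i, j)\<in>{(i, j). i + j = n + 1 \<and> i \<ge> 1 \<and> j \<ge> 2}. \<Sum>s=0..n - j.
         Poly_Mapping.single (circ (Fg i) s (Mu j)) ((-1) ^ (i + s * (j + 1))))"

section \<open>Derivations and the deformation complex\<close>

fun leaves :: "tree \<Rightarrow> nat" where
  "leaves Leaf = 1"
| "leaves (Node \<xi> ts) = sum_list (map leaves ts)"

lemma size_subtree: "i < length ts \<Longrightarrow> size (ts ! i) < size (Node \<xi> ts)"
  using size_list_estimation'[of "ts ! i" ts "size (ts ! i)" size] by simp

text \<open>A vertex is the path leading to it from the root.\<close>

function vertices :: "tree \<Rightarrow> nat list set" where
  "vertices Leaf = {}"
| "vertices (Node \<xi> ts) = insert [] (\<Union>i<length ts. (#) i ` vertices (ts ! i))"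
  by pat_completeness auto
termination
  by (relation "measure size") (auto intro: size_subtree simp del: tree.size)

text \<open>The inputs of the \<open>i\<close>-th subtree.\<close>

definition segment :: "tree list \<Rightarrow> nat \<Rightarrow> 'a list \<Rightarrow> 'a list" where
  "segment ts i xs = take (leaves (ts ! i)) (drop (sum_list (map leaves (take i ts))) xs)"

text \<open>
  Composite in \<open>End\<^sub>T\<close> along a tree; \<open>\<phi> p \<xi>\<close> is the operation at the vertex \<open>p\<close>, decorated by \<open>\<xi>\<close>.
\<close>

function tree_comp :: "(nat list \<Rightarrow> gen \<Rightarrow> ('u::zero, 'v::zero) endo) \<Rightarrow> tree \<Rightarrow> ('u, 'v) endo" where
  "tree_comp \<phi> Leaf xs = (if length xs = 1 then hd xs else 0)"
| "tree_comp \<phi> (Node \<xi> ts) xs = (if length xs = leaves (Node \<xi> ts)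
     then \<phi> [] \<xi> (map (\<lambda>i. tree_comp (\<lambda>p. \<phi> (i # p)) (ts ! i) (segment ts i xs)) [0..<length ts])
     else 0)"
  by pat_completeness auto
termination
  by (relation "measure (\<lambda>(\<phi>, t, xs). size t)") (auto intro: size_subtree simp del: tree.size)

text \<open>
  \<open>der_ext sU sV \<beta> \<theta>\<close> is the extension of \<open>\<theta>\<close> to a derivation of the free PROP, relative to the
  PROP morphism given by \<open>\<beta>\<close>.
\<close>

definition der_ext ::
  "('k::field \<Rightarrow> 'u::ab_group_add \<Rightarrow> 'u) \<Rightarrow> ('k \<Rightarrow> 'v::ab_group_add \<Rightarrow> 'v) \<Rightarrow> (gen \<Rightarrow> ('u, 'v) endo) \<Rightarrow>
   (gen \<Rightarrow> ('u, 'v) endo) \<Rightarrow> (tree \<Rightarrow>\<^sub>0 'k) \<Rightarrow> ('u, 'v) endo" where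
  "der_ext sU sV \<beta> \<theta> x = (\<Sum>t\<in>Poly_Mapping.keys x. endo_scale sU sV (Poly_Mapping.lookup x t)
     (\<Sum>v\<in>vertices t. tree_comp (\<lambda>p \<xi>. if p = v then \<theta> \<xi> else \<beta> \<xi>) t))"

definition beta :: "('u \<Rightarrow> 'v) \<Rightarrow> gen \<Rightarrow> ('u::ring, 'v::ring) endo" where
  "beta g \<xi> xs =
     (if \<not> list_all2 (\<lambda>x c. x \<in> T_part c) xs (replicate (arity \<xi>) (in_color \<xi>)) then 0
      else if \<xi> = Mu 2 then inB (fst (xs ! 0) * fst (xs ! 1))
      else if \<xi> = Nu 2 then inW (snd (xs ! 0) * snd (xs ! 1))
      else if \<xi> = Fg 1 then inW (g (fst (xs ! 0)))
      else 0)"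

text \<open>
  The linear map out of \<open>E\<close> that is equivariant and takes the values \<open>\<psi> \<xi>\<close> on generators. It is
  \<open>0\<close> on the basis vectors of \<open>'k bimod\<close> outside \<open>E\<close>.
\<close>

definition equivariant_ext ::
  "('k::field \<Rightarrow> 'u::ab_group_add \<Rightarrow> 'u) \<Rightarrow> ('k \<Rightarrow> 'v::ab_group_add \<Rightarrow> 'v) \<Rightarrow> (gen \<Rightarrow> ('u, 'v) endo) \<Rightarrow>
   'k bimod \<Rightarrow> ('u, 'v) endo" where
  "equivariant_ext sU sV \<psi> e = (\<Sum>(\<xi>, \<sigma>)\<in>Poly_Mapping.keys e \<inter> E_basis.
     endo_scale sU sV (Poly_Mapping.lookup e (\<xi>, \<sigma>)) (endo_act \<sigma> (\<psi> \<xi>)))"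

text \<open>
  Degree \<open>m\<close> of the deformation complex. The last condition restricts the support to the generators
  of degree \<open>m - 1\<close> and makes \<open>\<theta>\<close> vanish on the basis vectors of \<open>'k bimod\<close> outside \<open>E\<close>, so
  that \<open>\<theta>\<close> is determined by its restriction to \<open>E\<close>.
\<close>

definition C_As ::
  "('k::field \<Rightarrow> 'u::ab_group_add \<Rightarrow> 'u) \<Rightarrow> ('k \<Rightarrow> 'v::ab_group_add \<Rightarrow> 'v) \<Rightarrow> nat \<Rightarrow>
   ('k bimod \<Rightarrow> ('u, 'v) endo) set" where
  "C_As sU sV m = {\<theta>. Vector_Spaces.linear E_scale (endo_scale sU sV) \<theta> \<and>
     (\<forall>cs d. \<forall>e\<in>E_comp cs d. \<theta> e \<in> End_T sU sV cs d) \<and>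
     (\<forall>cs d \<tau>. \<forall>e\<in>E_comp cs d. \<tau> permutes {..<length cs} \<longrightarrow> \<theta> (E_act \<tau> e) = endo_act \<tau> (\<theta> e)) \<and>
     (\<forall>\<xi> \<sigma>. (\<xi>, \<sigma>) \<notin> E_basis \<or> gen_degree \<xi> \<noteq> int m - 1 \<longrightarrow>
        \<theta> (Poly_Mapping.single (\<xi>, \<sigma>) 1) = 0)}"

definition delta_As ::
  "('k::field \<Rightarrow> 'u::ring \<Rightarrow> 'u) \<Rightarrow> ('k \<Rightarrow> 'v::ring \<Rightarrow> 'v) \<Rightarrow> ('u \<Rightarrow> 'v) \<Rightarrow>
   ('k bimod \<Rightarrow> ('u, 'v) endo) \<Rightarrow> 'k bimod \<Rightarrow> ('u, 'v) endo" where
  "delta_As sU sV g \<theta> =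
     equivariant_ext sU sV (\<lambda>\<xi>. der_ext sU sV (beta g) (\<lambda>\<eta>. \<theta> (gen_vec \<eta>)) (bdry \<xi>))"

abbreviation As_scale ::
  "('k::field \<Rightarrow> 'u::ab_group_add \<Rightarrow> 'u) \<Rightarrow> ('k \<Rightarrow> 'v::ab_group_add \<Rightarrow> 'v) \<Rightarrow> 'k \<Rightarrow>
   ('k bimod \<Rightarrow> ('u, 'v) endo) \<Rightarrow> 'k bimod \<Rightarrow> ('u, 'v) endo" where
  "As_scale sU sV \<equiv> fun_scale (endo_scale sU sV)"

section \<open>The Gerstenhaber-Schack complex\<close>

text \<open>
  Hochschild differential of an \<open>n\<close>-cochain with values in a bimodule with left action \<open>l\<close> and right
  action \<open>r\<close>.
\<close>

definition hochschild ::
  "('k::field \<Rightarrow> 'm::ab_group_add \<Rightarrow> 'm) \<Rightarrow> ('a::ring \<Rightarrow> 'm \<Rightarrow> 'm) \<Rightarrow> ('m \<Rightarrow> 'a \<Rightarrow> 'm) \<Rightarrow> nat \<Rightarrow>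
   ('a list \<Rightarrow> 'm) \<Rightarrow> 'a list \<Rightarrow> 'm" where
  "hochschild sM l r n \<phi> as = (if length as = n + 1 then
       l (hd as) (\<phi> (tl as))
       + (\<Sum>i=1..n. sM ((-1) ^ i) (\<phi> (take (i - 1) as @ [as ! (i - 1) * as ! i] @ drop (i + 1) as)))
       + sM ((-1) ^ (n + 1)) (r (\<phi> (butlast as)) (last as))
     else 0)"

definition b_self :: "('k::field \<Rightarrow> 'a::ring \<Rightarrow> 'a) \<Rightarrow> nat \<Rightarrow> ('a list \<Rightarrow> 'a) \<Rightarrow> 'a list \<Rightarrow> 'a" where
  "b_self sA = hochschild sA (*) (*)"

definition b_via ::
  "('k::field \<Rightarrow> 'v::ring \<Rightarrow> 'v) \<Rightarrow> ('u::ring \<Rightarrow> 'v) \<Rightarrow> nat \<Rightarrow> ('u list \<Rightarrow> 'v) \<Rightarrow> 'u list \<Rightarrow> 'v" where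
  "b_via sV g = hochschild sV (\<lambda>u v. g u * v) (\<lambda>v u. v * g u)"

type_synonym ('u, 'v) gs = "('u list \<Rightarrow> 'u) \<times> ('v list \<Rightarrow> 'v) \<times> ('u list \<Rightarrow> 'v)"

text \<open>Only used for \<open>n \<ge> 1\<close>.\<close>

definition C_GS ::
  "('k \<Rightarrow> 'u::ab_group_add \<Rightarrow> 'u) \<Rightarrow> ('k \<Rightarrow> 'v::ab_group_add \<Rightarrow> 'v) \<Rightarrow> nat \<Rightarrow> ('u, 'v) gs set" where
  "C_GS sU sV n = hom_pow sU sU n \<times> hom_pow sV sV n \<times> hom_pow sU sV (n - 1)"

definition d_GS ::
  "('k::field \<Rightarrow> 'u::ring \<Rightarrow> 'u) \<Rightarrow> ('k \<Rightarrow> 'v::ring \<Rightarrow> 'v) \<Rightarrow> ('u \<Rightarrow> 'v) \<Rightarrow> nat \<Rightarrow> ('u, 'v) gs \<Rightarrow> ('u, 'v) gs" where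
  "d_GS sU sV g n = (\<lambda>(xU, xV, xg).
     (b_self sU n xU, b_self sV n xV,
      \<lambda>us. g (xU us) - xV (map g us) - b_via sV g (n - 1) xg us))"

definition gs_scale ::
  "('k \<Rightarrow> 'u \<Rightarrow> 'u) \<Rightarrow> ('k \<Rightarrow> 'v \<Rightarrow> 'v) \<Rightarrow> 'k \<Rightarrow> ('u, 'v) gs \<Rightarrow> ('u, 'v) gs" where
  "gs_scale sU sV c = (\<lambda>(xU, xV, xg). (fun_scale sU c xU, fun_scale sV c xV, fun_scale sV c xg))"

text \<open>
  The identification of \<open>C_As (n - 1)\<close> with \<open>C_GS n\<close>, and the differential on the latter induced by
  \<open>delta_As\<close>. No generator has degree \<open>-1\<close>, so \<open>C_As 0\<close> is \<open>0\<close>: for \<open>n = 1\<close> the map \<open>gs_tuple n\<close> is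
  injective, but not onto \<open>C_GS 1\<close> in general.
\<close>

definition gs_tuple ::
  "nat \<Rightarrow> ('k::zero_neq_one bimod \<Rightarrow> ('u::zero, 'v::zero) endo) \<Rightarrow> ('u, 'v) gs" where
  "gs_tuple n \<theta> =
     (\<lambda>us. fst (\<theta> (gen_vec (Mu n)) (map inB us)),
      \<lambda>vs. snd (\<theta> (gen_vec (Nu n)) (map inW vs)),
      \<lambda>us. snd (\<theta> (gen_vec (Fg (n - 1))) (map inB us)))"

definition delta_GS ::
  "('k::field \<Rightarrow> 'u::ring \<Rightarrow> 'u) \<Rightarrow> ('k \<Rightarrow> 'v::ring \<Rightarrow> 'v) \<Rightarrow> ('u \<Rightarrow> 'v) \<Rightarrow> nat \<Rightarrow> ('u, 'v) gs \<Rightarrow> ('u, 'v) gs" where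
  "delta_GS sU sV g n x =
     gs_tuple (n + 1) (delta_As sU sV g (inv_into (C_As sU sV (n - 1)) (gs_tuple n) x))"

definition gs_iso ::
  "('k::field \<Rightarrow> 'u::ab_group_add \<Rightarrow> 'u) \<Rightarrow> ('k \<Rightarrow> 'v::ab_group_add \<Rightarrow> 'v) \<Rightarrow> nat \<Rightarrow>
   ('k bimod \<Rightarrow> ('u, 'v) endo) \<Rightarrow> ('u, 'v) gs" where
  "gs_iso sU sV n \<theta> = (case gs_tuple n \<theta> of (\<theta>U, \<theta>V, \<theta>g) \<Rightarrow>
     (fun_scale sU ((-1) ^ (n * (n + 1) div 2)) \<theta>U,
      fun_scale sV ((-1) ^ (n * (n + 1) div 2)) \<theta>V,
      fun_scale sV ((-1) ^ ((n - 1) * n div 2)) \<theta>g))"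

end

(*
  A derivation is determined by its values on the generators mu_n, nu_n, f_n, and a map in C_As m is
  nonzero only on mu_(m+1), nu_(m+1) and f_m. Since beta vanishes on all generators except mu_2, nu_2
  and f_1, only those terms of the boundary of a generator contribute in which all vertices but one
  are decorated by mu_2, nu_2 or f_1. For mu_n o_(s+1) mu_2 these are the inner terms of the
  Hochschild differential, for mu_2 o_(s+1) mu_n the two outer ones; in the boundary of f_n the tree
  nu_n (f_1, ..., f_1) gives theta_V g^n and f_1 o_1 mu_n gives g theta_U. The sign twist turns the
  resulting differential into d_GS, whose square vanishes by the cosimplicial identities for the
  faces of the Hochschild differential. Linearity and square zero of delta_As then follow by
  transport along the injective map gs_iso.
*)
theory Submission
  imports Defs
begin

section \<open>Hochschild cochains\<close>

text \<open>One mechanism discards terms of the boundary: where an operation is zero, the composite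
  feeds 0 into the operation below it, and an operation that is linear in each input kills it. Terms
  are sorted by the vertex that carries the derivation before anything is discarded. For cochains
  with \<open>n = 2\<close> this matters, because one and the same tree then contributes with the
  derivation at the root and with it at an upper vertex.

  Equality means equality of total functions on lists over \<open>U \<times> V\<close>. So both
  sides of each formula must also agree, as 0, on lists of the wrong length or with an entry outside
  the summand. Extension by zero (\<open>transport\<close>) isolates this convention and leaves
  formulas between Hochschild cochains on \<open>U\<close> and \<open>V\<close>.

  The exponents in the isomorphism are triangular numbers \<open>t(n) = n (n + 1) / 2\<close>: the
  step from \<open>t(n)\<close> to \<open>t(n + 1)\<close> is \<open>n + 1\<close>, the exponent in
  front of \<open>b\<close> in degree \<open>n\<close>, and the last component uses
  \<open>t(n - 1)\<close> because its cochains have one argument less. Square zero is imported from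
  the Hochschild side, so composites along trees with more than two levels of vertices never have to
  be expanded.\<close>

fun contract :: "nat \<Rightarrow> 'a::times list \<Rightarrow> 'a list" where
  "contract 0 (a # b # xs) = a * b # xs"
| "contract (Suc k) (a # xs) = a # contract k xs"
| "contract 0 [] = []"
| "contract 0 [a] = [a]"
| "contract (Suc k) [] = []"

lemma length_contract: "Suc k < length xs \<Longrightarrow> length (contract k xs) = length xs - 1"
  by (induction k xs rule: contract.induct) auto

lemma contract_eq:
  "Suc k < length xs \<Longrightarrow> contract k xs = take k xs @ (xs ! k * xs ! Suc k) # drop (k + 2) xs"
  by (induction k xs rule: contract.induct) auto

text \<open>The simplicial identity for products of adjacent entries. For \<open>k < j\<close> the
  two products involve disjoint pairs of positions; for \<open>k = j\<close> the pairs overlap and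
  the identity is associativity.\<close>

lemma contract_contract:
  fixes xs :: "'a::semigroup_mult list"
  shows "k \<le> j \<Longrightarrow> j + 2 < length xs \<Longrightarrow> contract k (contract (Suc j) xs) = contract j (contract k xs)"
proof (induction k xs arbitrary: j rule: contract.induct)
  case (1 a b xs)
  then show ?case
    by (cases j; cases xs) (auto simp: mult.assoc)
next
  case (2 k a xs)
  then show ?case by (cases j) auto
qed auto

text \<open>The default equations return a list that is too short unchanged, so this holds without a
  bound on \<open>k\<close>. It is used to evaluate \<open>last\<close> and \<open>butlast\<close>
  of a list with a new head.\<close>

lemma contract_neq_Nil: "xs \<noteq> [] \<Longrightarrow> contract k xs \<noteq> []"
  by (induction k xs rule: contract.induct) auto

lemma last_butlast_contract:
  "k + 2 < length xs \<Longrightarrow> last (contract k xs) = last xs \<and> butlast (contract k xs) = contract k (butlast xs)"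
proof (induction k xs rule: contract.induct)
  case (2 k a xs)
  then have "xs \<noteq> []" "contract k xs \<noteq> []" by (auto intro!: contract_neq_Nil)
  with 2 show ?case by auto
qed auto

text \<open>The boundary case, in which the product absorbs the last entry. It supplies the right
  action of a product in the cosimplicial identity for the two highest faces.\<close>

lemma last_butlast_contract_end:
  "length xs = k + 2 \<Longrightarrow> last (contract k xs) = last (butlast xs) * last xs \<and>
    butlast (contract k xs) = butlast (butlast xs)"
proof (induction k xs rule: contract.induct)
  case (2 k a xs)
  then have "xs \<noteq> []" "contract k xs \<noteq> []" "butlast xs \<noteq> []"
    by (auto intro!: contract_neq_Nil simp flip: length_greater_0_conv)
  with 2 show ?case by auto
qed auto

lemma map_contract:
  "(\<And>x y. h (x * y) = h x * h y) \<Longrightarrow> map h (contract k xs) = contract k (map h xs)"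
  by (induction k xs rule: contract.induct) auto

text \<open>A changed entry stays where it is before position \<open>k\<close>, becomes a factor of
  the product at \<open>k\<close>, or moves down by one place. In each case exactly one entry of the
  result changes, which reduces multilinearity of an inner face to that of the cochain.\<close>

lemma contract_list_update:
  "Suc k < length xs \<Longrightarrow> contract k (xs[i := x]) =
    (if i < k then (contract k xs)[i := x]
     else if i = k then (contract k xs)[k := x * xs ! Suc k]
     else if i = Suc k then (contract k xs)[k := xs ! k * x]
     else (contract k xs)[i - 1 := x])"
proof (induction k xs arbitrary: i rule: contract.induct)
  case (1 a b xs)
  then show ?case by (auto split: nat.split simp: list_update_def)
next
  case (2 k a xs)
  then show ?case by (auto simp: less_Suc_eq_0_disj split: nat.split)
qed auto

lemma hom_pow_iff:
  "F \<in> hom_pow sA sM n \<longleftrightarrow>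
    (\<forall>xs. length xs \<noteq> n \<longrightarrow> F xs = 0) \<and>
    (\<forall>xs i x y c. length xs = n \<longrightarrow> i < n \<longrightarrow>
      F (xs[i := x + y]) = F (xs[i := x]) + F (xs[i := y]) \<and>
      F (xs[i := sA c x]) = sM c (F (xs[i := x])))"
  unfolding tensor_hom_def list_all2_conv_all_nth by auto

text \<open>Terms with \<open>i < j\<close> cancel against terms with \<open>j \<le> i\<close>: the
  index \<open>(j, i)\<close> is matched with \<open>(i, j - 1)\<close>, where the value is the same
  by assumption and the sum of the indices differs by one, so the sign is opposite.\<close>

lemma (in vector_space) alternating_sum_eq_0:
  fixes G :: "nat \<Rightarrow> nat \<Rightarrow> 'b"
  assumes "\<And>i j. i < j \<Longrightarrow> j \<le> Suc N \<Longrightarrow> G j i = G i (j - 1)"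
  shows "(\<Sum>j\<le>Suc N. \<Sum>i\<le>N. scale ((-1) ^ (i + j)) (G j i)) = 0"
proof -
  define h where "h = (\<lambda>(j, i). scale ((-1) ^ (i + j)) (G j i))"
  define A where "A = {(j, i). j \<le> Suc N \<and> i \<le> N \<and> i < j}"
  define B where "B = {(j, i). j \<le> Suc N \<and> i \<le> N \<and> j \<le> i}"
  have fin: "finite A" "finite B"
    by (rule finite_subset[of _ "{..Suc N} \<times> {..N}"]; auto simp: A_def B_def)+
  have "(\<Sum>j\<le>Suc N. \<Sum>i\<le>N. scale ((-1) ^ (i + j)) (G j i)) = sum h ({..Suc N} \<times> {..N})"
    by (simp add: sum.cartesian_product h_def)
  also have "{..Suc N} \<times> {..N} = A \<union> B"
    by (auto simp: A_def B_def)
  also have "sum h (A \<union> B) = sum h A + sum h B"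
    using fin by (intro sum.union_disjoint) (auto simp: A_def B_def)
  also have "sum h B = (\<Sum>p\<in>A. - h p)"
  proof (rule sum.reindex_bij_witness[of _ "\<lambda>(j, i). (i, j - 1)" "\<lambda>(j, i). (Suc i, j)"])
    fix p assume "p \<in> B"
    then show "- h (case p of (j, i) \<Rightarrow> (Suc i, j)) = h p"
      using assms by (auto simp: B_def h_def add.commute)
  qed (auto simp: A_def B_def)
  also have "sum h A + \<dots> = 0"
    by (simp add: sum_negf)
  finally show ?thesis .
qed

section \<open>Cosimplicial faces of Hochschild cochains with values in a bimodule\<close>

locale bimodule = alg: assoc_algebra sA + M: vector_space sM
  for sA :: "'k::field \<Rightarrow> 'a::ring \<Rightarrow> 'a" and sM :: "'k \<Rightarrow> 'm::ab_group_add \<Rightarrow> 'm" +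
  fixes l :: "'a \<Rightarrow> 'm \<Rightarrow> 'm" and r :: "'m \<Rightarrow> 'a \<Rightarrow> 'm"
  assumes l_add: "l a (x + y) = l a x + l a y"
    and l_scale: "l a (sM c x) = sM c (l a x)"
    and l_add_left: "l (a + b) x = l a x + l b x"
    and l_scale_left: "l (sA c a) x = sM c (l a x)"
    and r_add: "r (x + y) a = r x a + r y a"
    and r_scale: "r (sM c x) a = sM c (r x a)"
    and r_add_right: "r x (a + b) = r x a + r x b"
    and r_scale_right: "r x (sA c a) = sM c (r x a)"
    and l_mult: "l (a * b) x = l a (l b x)"
    and r_mult: "r x (a * b) = r (r x a) b"
    and l_r: "l a (r x b) = r (l a x) b"
begin

text \<open>The coface maps of the cosimplicial module behind the Hochschild complex. The index runs
  from 0 to \<open>n + 1\<close>, whereas \<open>contract\<close> counts positions from 0, hence the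
  shift \<open>i - 1\<close>.\<close>

definition face :: "nat \<Rightarrow> nat \<Rightarrow> ('a list \<Rightarrow> 'm) \<Rightarrow> 'a list \<Rightarrow> 'm" where
  "face n i \<phi> as =
    (if i = 0 then l (hd as) (\<phi> (tl as))
     else if i \<le> n then \<phi> (contract (i - 1) as)
     else r (\<phi> (butlast as)) (last as))"

abbreviation b :: "nat \<Rightarrow> ('a list \<Rightarrow> 'm) \<Rightarrow> 'a list \<Rightarrow> 'm" where
  "b \<equiv> hochschild sM l r"

lemma l_zero [simp]: "l a 0 = 0"
  using l_add[of a 0 0] by simp

lemma r_zero [simp]: "r 0 a = 0"
  using r_add[of 0 0 a] by simp

lemma l_sum: "l a (sum f S) = (\<Sum>i\<in>S. l a (f i))"
  by (induction S rule: infinite_finite_induct) (auto simp: l_add)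

lemma r_sum: "r (sum f S) a = (\<Sum>i\<in>S. r (f i) a)"
  by (induction S rule: infinite_finite_induct) (auto simp: r_add)

lemma hochschild_faces:
  assumes "length as = n + 1"
  shows "b n \<phi> as = (\<Sum>i\<le>Suc n. sM ((-1) ^ i) (face n i \<phi> as))"
proof -
  have "(\<Sum>i\<le>Suc n. sM ((-1) ^ i) (face n i \<phi> as)) =
      face n 0 \<phi> as + (\<Sum>i=1..n. sM ((-1) ^ i) (face n i \<phi> as)) + sM ((-1) ^ (n + 1)) (face n (n + 1) \<phi> as)"
    by (simp add: atMost_atLeast0 sum.atLeast_Suc_atMost[of 0 n])
  also have "(\<Sum>i=1..n. sM ((-1) ^ i) (face n i \<phi> as)) =
    (\<Sum>i=1..n. sM ((-1) ^ i) (\<phi> (take (i - 1) as @ [as ! (i - 1) * as ! i] @ drop (i + 1) as)))"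
    using assms by (intro sum.cong) (auto simp: face_def contract_eq)
  finally show ?thesis
    using assms by (simp add: hochschild_def face_def)
qed

text \<open>A face evaluates its cochain only on lists with \<open>n\<close> entries. This permits
  the expansion of \<open>b n \<phi>\<close> into faces, valid only at the right length, underneath
  another face.\<close>

lemma face_cong:
  assumes "length as = Suc n" "\<And>bs. length bs = n \<Longrightarrow> \<phi> bs = \<psi> bs"
  shows "face n i \<phi> as = face n i \<psi> as"
  using assms by (auto simp: face_def length_contract)

lemma face_sum: "face n i (\<lambda>as. \<Sum>j\<in>S. sM (c j) (F j as)) as = (\<Sum>j\<in>S. sM (c j) (face n i (F j) as))"
  by (simp add: face_def l_sum r_sum l_scale r_scale)

text \<open>The cosimplicial identity, with one case for each bimodule axiom: the left action of a
  product for \<open>i = 0\<close>, \<open>j = 1\<close>, commutation of the two actions for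
  \<open>i = 0\<close>, \<open>j = n + 2\<close>, and the right action of a product for the two
  highest faces. Two inner faces are \<open>contract_contract\<close>; an outer face and an inner
  face away from it touch disjoint entries.\<close>

lemma face_face:
  assumes "length as = n + 2" "i < j" "j \<le> n + 2"
  shows "face (Suc n) j (face n i \<phi>) as = face (Suc n) i (face n (j - 1) \<phi>) as"
proof -
  obtain a bs where as: "as = a # bs" "length bs = Suc n"
    using assms(1) by (cases as) auto
  obtain b' cs where bs: "bs = b' # cs" "length cs = n"
    using as(2) by (cases bs) auto
  obtain ds e where bs': "bs = ds @ [e]" "length ds = n"
    using as(2) by (cases bs rule: rev_cases) auto
  have as3: "as = a # b' # cs" "as = a # ds @ [e]"
    using as bs bs' by auto
  consider "i = 0" "j = 1" | "i = 0" "1 < j" "j \<le> n + 1" | "i = 0" "j = n + 2"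
    | "0 < i" "j \<le> n + 1" | "0 < i" "i \<le> n" "j = n + 2" | "i = n + 1" "j = n + 2"
    using assms by linarith
  then show ?thesis
  proof cases
    case 1
    then show ?thesis using as3(1) bs(2) by (simp add: face_def l_mult)
  next
    case 2
    define k where "k = j - 2"
    have "j = Suc (Suc k)" using 2 by (simp add: k_def)
    then show ?thesis using 2 as by (simp add: face_def)
  next
    case 3
    then show ?thesis using as3(2) bs'(2) by (simp add: face_def l_r)
  next
    case 4
    define p q where "p = i - 1" and "q = j - 2"
    have "i = Suc p" "j = Suc (Suc q)" "p \<le> q"
      using 4 assms by (simp_all add: p_def q_def)
    then show ?thesis using 4 assms by (simp add: face_def contract_contract)
  next
    case 5
    define p where "p = i - 1"
    have "i = Suc p" using 5 by (simp add: p_def)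
    then show ?thesis using 5 assms last_butlast_contract[of p as] by (simp add: face_def)
  next
    case 6
    show ?thesis unfolding 6 using assms(1) last_butlast_contract_end[of as n] by (simp add: face_def r_mult)
  qed
qed

lemma b_squared: "b (Suc n) (b n \<phi>) as = 0"
proof (cases "length as = n + 2")
  case True
  have "b (Suc n) (b n \<phi>) as = (\<Sum>j\<le>Suc (Suc n). sM ((-1) ^ j) (face (Suc n) j (b n \<phi>) as))"
    using True by (simp add: hochschild_faces)
  also have "\<dots> = (\<Sum>j\<le>Suc (Suc n). sM ((-1) ^ j)
      (face (Suc n) j (\<lambda>as. \<Sum>i\<le>Suc n. sM ((-1) ^ i) (face n i \<phi> as)) as))"
    using True by (intro sum.cong refl arg_cong[where f = "sM _"] face_cong) (auto simp: hochschild_faces)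
  also have "\<dots> = (\<Sum>j\<le>Suc (Suc n). \<Sum>i\<le>Suc n. sM ((-1) ^ (i + j)) (face (Suc n) j (face n i \<phi>) as))"
    by (simp only: face_sum M.scale_sum_right M.scale_scale power_add mult.commute)
  also have "\<dots> = 0"
    using True by (intro M.alternating_sum_eq_0 face_face) auto
  finally show ?thesis .
qed (simp add: hochschild_def)

lemma b_linear_combination:
  "b n (\<lambda>as. sM c (\<phi> as) + sM d (\<psi> as)) as = sM c (b n \<phi> as) + sM d (b n \<psi> as)"
proof (cases "length as = n + 1")
  case True
  have "face n i (\<lambda>as. sM c (\<phi> as) + sM d (\<psi> as)) as = sM c (face n i \<phi> as) + sM d (face n i \<psi> as)" for i
    by (simp add: face_def l_add r_add l_scale r_scale)
  then show ?thesis
    using True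
    by (simp only: hochschild_faces M.scale_right_distrib M.scale_scale mult.commute sum.distrib M.scale_sum_right)
qed (simp add: hochschild_def)

text \<open>In an outer face the changed entry may be the one that acts, which uses linearity of the
  action in the algebra element. In an inner face it may be a factor of the product, which uses
  distributivity.\<close>

lemma face_update:
  assumes "\<phi> \<in> hom_pow sA sM n" "length as = Suc n" "k < Suc n" "i \<le> Suc n"
  shows "face n i \<phi> (as[k := x + y]) = face n i \<phi> (as[k := x]) + face n i \<phi> (as[k := y])"
    and "face n i \<phi> (as[k := sA c x]) = sM c (face n i \<phi> (as[k := x]))"
proof -
  note \<phi> = assms(1)[unfolded hom_pow_iff, THEN conjunct2, rule_format]
  consider "i = 0" | "0 < i" "i \<le> n" | "i = Suc n" "n < i"
    using assms by linarith
  then have "face n i \<phi> (as[k := x + y]) = face n i \<phi> (as[k := x]) + face n i \<phi> (as[k := y]) \<and>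
    face n i \<phi> (as[k := sA c x]) = sM c (face n i \<phi> (as[k := x]))"
  proof cases
    case 1
    then show ?thesis
      using assms \<phi> by (cases as; cases k) (auto simp: face_def l_add l_scale l_add_left l_scale_left)
  next
    case 2
    then obtain p where "i = Suc p" by (cases i) auto
    then show ?thesis
      using assms 2 \<phi>
      by (auto simp: face_def contract_list_update length_contract distrib_right distrib_left
          alg.scale_mult_left alg.scale_mult_right)
  next
    case 3
    then show ?thesis
      using assms \<phi> 
      by (cases as rule: rev_cases; cases "k = n")
        (auto simp: face_def list_update_append r_add r_scale r_add_right r_scale_right)
  qed
  then show "face n i \<phi> (as[k := x + y]) = face n i \<phi> (as[k := x]) + face n i \<phi> (as[k := y])"
    and "face n i \<phi> (as[k := sA c x]) = sM c (face n i \<phi> (as[k := x]))" by auto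
qed

lemma b_hom_pow:
  assumes "\<phi> \<in> hom_pow sA sM n"
  shows "b n \<phi> \<in> hom_pow sA sM (Suc n)"
  unfolding hom_pow_iff
proof (intro conjI allI impI)
  fix as :: "'a list" and k x y c
  assume as: "length as = Suc n" "k < Suc n"
  show "b n \<phi> (as[k := x + y]) = b n \<phi> (as[k := x]) + b n \<phi> (as[k := y])"
    using as by (simp add: hochschild_faces face_update[OF assms] M.scale_right_distrib sum.distrib
        del: sum.atMost_Suc)
  show "b n \<phi> (as[k := sA c x]) = sM c (b n \<phi> (as[k := x]))"
    using as by (simp add: hochschild_faces face_update[OF assms] M.scale_sum_right mult.commute
        del: sum.atMost_Suc)
qed (simp add: hochschild_def)

end

section \<open>Linear extensions\<close>

lemma lookup_map_mult: "Poly_Mapping.lookup (Poly_Mapping.map ((*) c) e) k = (c::'k::mult_zero) * Poly_Mapping.lookup e k"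
  by (auto simp: Poly_Mapping.map.rep_eq when_def)

lemma vector_space_E_scale: "vector_space (E_scale :: 'k::field \<Rightarrow> 'k bimod \<Rightarrow> 'k bimod)"
  by unfold_locales
    (auto intro!: poly_mapping_eqI simp: E_scale_def lookup_map_mult lookup_add algebra_simps)

lemma fun_scale_apply: "fun_scale s c F x = s c (F x)"
  by (simp add: fun_scale_def)

lemma vector_space_fun_scale:
  assumes "vector_space s"
  shows "vector_space (fun_scale s)"
proof -
  interpret vector_space s by fact
  show ?thesis
    by unfold_locales (auto simp: fun_scale_def algebra_simps)
qed

lemma sum_fun_apply: "(\<Sum>i\<in>I. F i) x = (\<Sum>i\<in>I. F i x)"
  by (induction I rule: infinite_finite_induct) auto

text \<open>Linear extension from the basis of point masses. It covers \<open>der_ext\<close>, with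
  trees as the basis, and \<open>equivariant_ext\<close>, with pairs of a generator and a
  permutation.\<close>

definition lin_ext ::
  "('k::zero \<Rightarrow> 'm \<Rightarrow> 'm::comm_monoid_add) \<Rightarrow> ('t \<Rightarrow> 'm) \<Rightarrow> ('t \<Rightarrow>\<^sub>0 'k) \<Rightarrow> 'm" where
  "lin_ext s D x = (\<Sum>t\<in>Poly_Mapping.keys x. s (Poly_Mapping.lookup x t) (D t))"

context vector_space
begin

text \<open>Coefficients may cancel, so the support of a sum can be smaller than the union of the
  supports. Summing over a common finite set makes additivity a termwise statement.\<close>

lemma lin_ext_superset:
  assumes "finite S" "Poly_Mapping.keys x \<subseteq> S"
  shows "lin_ext scale D x = (\<Sum>t\<in>S. scale (Poly_Mapping.lookup x t) (D t))"
  unfolding lin_ext_def using assms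
  by (intro sum.mono_neutral_left) (auto simp: in_keys_iff)

lemma lin_ext_zero [simp]: "lin_ext scale D 0 = 0"
  by (simp add: lin_ext_def)

lemma lin_ext_single [simp]: "lin_ext scale D (Poly_Mapping.single t c) = scale c (D t)"
  by (cases "c = 0") (auto simp: lin_ext_def)

lemma lin_ext_add: "lin_ext scale D (x + y) = lin_ext scale D x + lin_ext scale D y"
proof -
  let ?S = "Poly_Mapping.keys x \<union> Poly_Mapping.keys y"
  have "lin_ext scale D (x + y) = (\<Sum>t\<in>?S. scale (Poly_Mapping.lookup (x + y) t) (D t))"
    using keys_add[of x y] by (intro lin_ext_superset) auto
  also have "\<dots> = lin_ext scale D x + lin_ext scale D y"
    by (simp add: lookup_add scale_left_distrib sum.distrib lin_ext_superset[of ?S])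
  finally show ?thesis .
qed

lemma lin_ext_uminus: "lin_ext scale D (- x) = - lin_ext scale D x"
  using lin_ext_add[of D x "- x"] by (simp add: add_eq_0_iff)

lemma lin_ext_diff: "lin_ext scale D (x - y) = lin_ext scale D x - lin_ext scale D y"
  using lin_ext_add[of D x "- y"] by (simp add: lin_ext_uminus)

lemma lin_ext_sum: "lin_ext scale D (sum f S) = (\<Sum>i\<in>S. lin_ext scale D (f i))"
  by (induction S rule: infinite_finite_induct) (auto simp: lin_ext_add)

lemma lin_ext_map_mult: "lin_ext scale D (Poly_Mapping.map ((*) c) x) = scale c (lin_ext scale D x)"
proof -
  have "lin_ext scale D (Poly_Mapping.map ((*) c) x) =
      (\<Sum>t\<in>Poly_Mapping.keys x. scale (Poly_Mapping.lookup (Poly_Mapping.map ((*) c) x) t) (D t))"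
    by (intro lin_ext_superset) (auto simp: in_keys_iff lookup_map_mult)
  then show ?thesis
    by (simp add: lookup_map_mult lin_ext_def scale_sum_right)
qed

lemma linear_eq_lin_ext:
  assumes "Vector_Spaces.linear E_scale scale f"
  shows "f x = lin_ext scale (\<lambda>t. f (Poly_Mapping.single t 1)) x"
proof -
  interpret f: Vector_Spaces.linear E_scale scale f by fact
  have "x = (\<Sum>t\<in>Poly_Mapping.keys x. E_scale (Poly_Mapping.lookup x t) (Poly_Mapping.single t 1))"
    by (rule poly_mapping_eqI)
      (auto simp: lookup_sum E_scale_def lookup_map_mult lookup_single when_def not_in_keys_iff_lookup_eq_zero)
  then have "f x = f (\<Sum>t\<in>Poly_Mapping.keys x. E_scale (Poly_Mapping.lookup x t) (Poly_Mapping.single t 1))"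
    by simp
  also have "\<dots> = lin_ext scale (\<lambda>t. f (Poly_Mapping.single t 1)) x"
    by (simp add: f.sum f.scale lin_ext_def)
  finally show ?thesis .
qed

lemma linear_lin_ext: "Vector_Spaces.linear E_scale scale (lin_ext scale D)"
  using vector_space_E_scale vector_space_axioms
  by (simp add: Vector_Spaces.linear_iff lin_ext_add lin_ext_map_mult E_scale_def)

end

section \<open>Multilinear maps\<close>

lemma list_all2_mem_replicate: "list_all2 (\<in>) xs (replicate n W) \<longleftrightarrow> length xs = n \<and> set xs \<subseteq> W"
  by (auto simp: list_all2_conv_all_nth in_set_conv_nth subset_iff)

lemma tensor_hom_replicate_iff:
  "F \<in> tensor_hom sA sM (replicate n W) M \<longleftrightarrow>
    (\<forall>xs. \<not> (length xs = n \<and> set xs \<subseteq> W) \<longrightarrow> F xs = 0) \<and>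
    (\<forall>xs. length xs = n \<longrightarrow> set xs \<subseteq> W \<longrightarrow> F xs \<in> M \<and>
      (\<forall>i<n. \<forall>x\<in>W. \<forall>y\<in>W. \<forall>c. F (xs[i := x + y]) = F (xs[i := x]) + F (xs[i := y]) \<and>
        F (xs[i := sA c x]) = sM c (F (xs[i := x]))))"
  by (simp add: tensor_hom_def list_all2_mem_replicate imp_conjL)

text \<open>Linearity in the slot of the zero entry, applied to \<open>0 + 0\<close>; off the domain
  the value is 0 by convention. This is what discards a composite one of whose inner operations
  vanishes.\<close>

lemma tensor_hom_zero_entry:
  assumes F: "F \<in> tensor_hom sA sM (replicate n W) M" and "0 \<in> set xs"
  shows "F xs = 0"
proof (cases "length xs = n \<and> set xs \<subseteq> W")
  case True
  then obtain i where i: "i < n" "xs ! i = 0"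
    using assms(2) by (auto simp: in_set_conv_nth)
  have "0 \<in> W" using True assms(2) by auto
  with F True i(1) have "F (xs[i := 0 + 0]) = F (xs[i := 0]) + F (xs[i := 0])"
    unfolding tensor_hom_replicate_iff by blast
  moreover have "xs[i := 0] = xs"
    using i by (metis list_update_id)
  ultimately show ?thesis by simp
next
  case False
  then show ?thesis using F unfolding tensor_hom_replicate_iff by blast
qed

lemma subspace_tensor_hom:
  assumes "vector_space sM" "module.subspace sM M"
  shows "module.subspace (fun_scale sM) (tensor_hom sA sM Ws M)"
proof -
  interpret vector_space sM by fact
  interpret F: vector_space "fun_scale sM" by (rule vector_space_fun_scale) fact
  show ?thesis
    using assms(2) unfolding F.subspace_def subspace_def tensor_hom_def
    by (auto simp: fun_scale_def algebra_simps)
qed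

lemma permute_list_update:
  assumes "p permutes {..<length xs}"
  shows "permute_list p (xs[i := x]) = (permute_list p xs)[inv p i := x]"
proof (rule nth_equalityI)
  fix k assume "k < length (permute_list p (xs[i := x]))"
  then have k: "k < length xs" by simp
  then have "p k < length xs"
    using permutes_in_image[OF assms, of k] by simp
  moreover have "p k = i \<longleftrightarrow> inv p i = k"
    using permutes_inverses[OF assms] by metis
  ultimately show "permute_list p (xs[i := x]) ! k = (permute_list p xs)[inv p i := x] ! k"
    using k assms by (auto simp: permute_list_nth nth_list_update)
qed simp

text \<open>All slots carry the same subspace \<open>W\<close>, so permuting the entries preserves
  the domain; a change in slot \<open>i\<close> becomes a change in slot
  \<open>\<sigma> i\<close>.\<close>

lemma endo_act_tensor_hom:
  assumes F: "F \<in> tensor_hom sA sM (replicate n W) M" and "\<sigma> permutes {..<n}"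
  shows "endo_act \<sigma> F \<in> tensor_hom sA sM (replicate n W) M"
proof -
  have \<sigma>: "inv \<sigma> permutes {..<n}" "inv (inv \<sigma>) = \<sigma>" "\<sigma> i < n \<longleftrightarrow> i < n" for i
    using permutes_inv[OF assms(2)] permutes_inv_inv[OF assms(2)] permutes_in_image[OF assms(2), of i]
    by auto
  show ?thesis
    using F \<sigma> unfolding tensor_hom_replicate_iff endo_act_def
    by (simp add: permute_list_update)
qed

text \<open>Inversion reverses the order of composition, so permuting by inverses is a right action.
  At lengths other than \<open>n\<close> both sides are 0.\<close>

lemma endo_act_comp:
  assumes F: "F \<in> tensor_hom sA sM (replicate n W) M" and "\<sigma> permutes {..<n}" "\<tau> permutes {..<n}"
  shows "endo_act (\<sigma> \<circ> \<tau>) F = endo_act \<tau> (endo_act \<sigma> F)"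
proof
  fix xs
  show "endo_act (\<sigma> \<circ> \<tau>) F xs = endo_act \<tau> (endo_act \<sigma> F) xs"
  proof (cases "length xs = n")
    case True
    have "inv (\<sigma> \<circ> \<tau>) = inv \<tau> \<circ> inv \<sigma>"
      using assms(2,3) by (intro o_inv_distrib permutes_bij)
    then show ?thesis
      using True permutes_inv[OF assms(2)] by (simp add: endo_act_def permute_list_compose)
  next
    case False
    then show ?thesis using F unfolding tensor_hom_replicate_iff endo_act_def by simp
  qed
qed

section \<open>Maps between direct summands\<close>

locale summand = e: Vector_Spaces.linear sA sT e + p: Vector_Spaces.linear sT sA p
  for sA :: "'k::field \<Rightarrow> 'a::ab_group_add \<Rightarrow> 'a" and sT :: "'k \<Rightarrow> 't::ab_group_add \<Rightarrow> 't"
    and e :: "'a \<Rightarrow> 't" and p :: "'t \<Rightarrow> 'a" +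
  assumes p_e [simp]: "p (e a) = a"
begin

lemma map_p_map_e [simp]: "map p (map e as) = as"
  by (induction as) auto

lemma map_e_map_p: "set xs \<subseteq> range e \<Longrightarrow> map e (map p xs) = xs"
  by (induction xs) auto

end

text \<open>Extension by zero from lists over the summand to lists over the ambient space. It is
  inverse to restriction along the inclusion \<open>e\<close> followed by the projection of the
  values.\<close>

definition transport :: "('a \<Rightarrow> 't) \<Rightarrow> ('t \<Rightarrow> 'a) \<Rightarrow> ('m \<Rightarrow> 's::zero) \<Rightarrow> ('a list \<Rightarrow> 'm) \<Rightarrow> 't list \<Rightarrow> 's" where
  "transport e p e' F xs = (if set xs \<subseteq> range e then e' (F (map p xs)) else 0)"

locale summand_pair = src: summand sA sT e p + tgt: summand sM sT' e' p'
  for sA :: "'k::field \<Rightarrow> 'a::ab_group_add \<Rightarrow> 'a" and sT :: "'k \<Rightarrow> 't::ab_group_add \<Rightarrow> 't"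
    and e :: "'a \<Rightarrow> 't" and p :: "'t \<Rightarrow> 'a"
    and sM :: "'k \<Rightarrow> 'm::ab_group_add \<Rightarrow> 'm" and sT' :: "'k \<Rightarrow> 's::ab_group_add \<Rightarrow> 's"
    and e' :: "'m \<Rightarrow> 's" and p' :: "'s \<Rightarrow> 'm"
begin

lemma range_closed: "x \<in> range e \<Longrightarrow> y \<in> range e \<Longrightarrow> x + y \<in> range e"
  "x \<in> range e \<Longrightarrow> sT c x \<in> range e"
  by (auto simp flip: src.e.add src.e.scale)

lemma transport_tensor_hom:
  assumes "F \<in> hom_pow sA sM n"
  shows "transport e p e' F \<in> tensor_hom sT sT' (replicate n (range e)) (range e')"
proof -
  note F = assms[unfolded hom_pow_iff, THEN conjunct1, rule_format]
    assms[unfolded hom_pow_iff, THEN conjunct2, rule_format]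
  have upd: "set (xs[i := x]) \<subseteq> range e" if "set xs \<subseteq> range e" "x \<in> range e" for xs i x
    using set_update_subset_insert[of xs i x] that by blast
  show ?thesis
    unfolding tensor_hom_replicate_iff
    using F by (auto simp: transport_def upd range_closed map_update src.p.add src.p.scale
        tgt.e.add tgt.e.scale)
qed

text \<open>A map in \<open>tensor_hom\<close> is already 0 off \<open>range e\<close> and takes its
  values in \<open>range e'\<close>, so restricting and extending by zero loses nothing. Hence a
  component of \<open>End_T\<close> and a space of Hochschild cochains hold the same data.\<close>

lemma transport_inverse:
  assumes G: "G \<in> tensor_hom sT sT' (replicate n (range e)) (range e')"
  shows "(\<lambda>as. p' (G (map e as))) \<in> hom_pow sA sM n"
    and "transport e p e' (\<lambda>as. p' (G (map e as))) = G"
proof -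
  note G' = G[unfolded tensor_hom_replicate_iff, THEN conjunct1, rule_format]
    G[unfolded tensor_hom_replicate_iff, THEN conjunct2, rule_format]
  show "(\<lambda>as. p' (G (map e as))) \<in> hom_pow sA sM n"
    unfolding hom_pow_iff
  proof (intro conjI allI impI)
    fix as :: "'a list" and i x y c
    assume as: "length as = n" "i < n"
    have sub: "set (map e as) \<subseteq> range e" by auto
    show "p' (G (map e (as[i := x + y]))) = p' (G (map e (as[i := x]))) + p' (G (map e (as[i := y])))"
      using G'(2)[of "map e as"] as sub by (simp add: map_update src.e.add tgt.p.add)
    show "p' (G (map e (as[i := sA c x]))) = sM c (p' (G (map e (as[i := x]))))"
      using G'(2)[of "map e as"] as sub by (simp add: map_update src.e.scale tgt.p.scale)
  qed (simp add: G' tgt.p.zero)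
  show "transport e p e' (\<lambda>as. p' (G (map e as))) = G"
  proof
    fix xs
    show "transport e p e' (\<lambda>as. p' (G (map e as))) xs = G xs"
    proof (cases "set xs \<subseteq> range e")
      case True
      \<comment> \<open>At a wrong length the value is 0, which lies in the range as the image of
        0.\<close>
      have "G xs \<in> range e'"
        using True G' tgt.e.zero by (cases "length xs = n") (auto intro: range_eqI[of _ _ 0])
      then show ?thesis
        using True src.map_e_map_p[OF True] by (auto simp: transport_def)
    next
      case False
      then show ?thesis using G' by (simp add: transport_def)
    qed
  qed
qed

lemma p'_transport [simp]: "p' (transport e p e' F (map e as)) = F as"
  by (auto simp: transport_def simp del: map_map)

end

section \<open>The deformation complex in terms of generators\<close>

lemma T_part_range: "T_part Black = range inB" "T_part White = range inW"
  by (auto simp: T_part_def inB_def inW_def)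

text \<open>The component of \<open>End_T\<close> in which the value of a cochain on the generator
  lies. All inputs of a generator share one color, so its input profile is a constant list and the
  results on \<open>replicate\<close> apply.\<close>

definition gen_space ::
  "('k::field \<Rightarrow> 'u::ab_group_add \<Rightarrow> 'u) \<Rightarrow> ('k \<Rightarrow> 'v::ab_group_add \<Rightarrow> 'v) \<Rightarrow> gen \<Rightarrow> ('u, 'v) endo set" where
  "gen_space sU sV \<xi> = tensor_hom (T_scale sU sV) (T_scale sU sV)
     (replicate (arity \<xi>) (T_part (in_color \<xi>))) (T_part (out_color \<xi>))"

lemma End_T_gen: "End_T sU sV (replicate (arity \<xi>) (in_color \<xi>)) (out_color \<xi>) = gen_space sU sV \<xi>"
  by (simp add: End_T_def gen_space_def)

context algebra_morphism
begin

sublocale T: vector_space_prod sU sV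
  by unfold_locales

sublocale endo: vector_space "endo_scale sU sV"
  by (rule vector_space_fun_scale) unfold_locales

sublocale As: vector_space "As_scale sU sV"
  by (rule vector_space_fun_scale) unfold_locales

sublocale B: summand sU "T_scale sU sV" inB fst
  by unfold_locales (auto simp: inB_def T.scale_def)

sublocale W: summand sV "T_scale sU sV" inW snd
  by unfold_locales (auto simp: inW_def T.scale_def)

sublocale BB: summand_pair sU "T_scale sU sV" inB fst sU "T_scale sU sV" inB fst
  by unfold_locales

sublocale WW: summand_pair sV "T_scale sU sV" inW snd sV "T_scale sU sV" inW snd
  by unfold_locales

sublocale BW: summand_pair sU "T_scale sU sV" inB fst sV "T_scale sU sV" inW snd
  by unfold_locales

lemma subspace_T_part: "T.p.subspace (T_part c)"
  by (cases c) (auto simp: T.p.subspace_def T_part_def T.scale_def zero_prod_def)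

lemma subspace_End_T: "endo.subspace (End_T sU sV cs d)"
  unfolding End_T_def by (intro subspace_tensor_hom subspace_T_part) unfold_locales

lemma endo_act_add: "endo_act \<tau> (F + G) = endo_act \<tau> F + endo_act \<tau> G"
  by (auto simp: endo_act_def)

lemma endo_act_zero [simp]: "endo_act \<tau> 0 = 0"
  by (auto simp: endo_act_def)

lemma endo_act_scale: "endo_act \<tau> (endo_scale sU sV c F) = endo_scale sU sV c (endo_act \<tau> F)"
  by (auto simp: endo_act_def fun_scale_def)

lemma endo_act_sum: "endo_act \<tau> (sum F I) = (\<Sum>i\<in>I. endo_act \<tau> (F i))"
  by (rule ext) (simp add: endo_act_def sum_fun_apply)

lemma equivariant_ext_lin_ext:
  "equivariant_ext sU sV \<psi> =
    lin_ext (endo_scale sU sV) (\<lambda>(\<xi>, \<sigma>). if (\<xi>, \<sigma>) \<in> E_basis then endo_act \<sigma> (\<psi> \<xi>) else 0)"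
proof (rule ext)
  show "equivariant_ext sU sV \<psi> e =
    lin_ext (endo_scale sU sV) (\<lambda>(\<xi>, \<sigma>). if (\<xi>, \<sigma>) \<in> E_basis then endo_act \<sigma> (\<psi> \<xi>) else 0) e" for e
    unfolding equivariant_ext_def lin_ext_def by (intro sum.mono_neutral_cong_left) auto
qed

lemma equivariant_ext_gen_vec:
  assumes "is_gen \<xi>"
  shows "equivariant_ext sU sV \<psi> (gen_vec \<xi>) = \<psi> \<xi>"
  using assms by (auto simp: equivariant_ext_lin_ext gen_vec_def E_basis_def permutes_id endo_act_def)

text \<open>Existence half of freeness: each generator spans a free module over its symmetric group,
  so values of the right color type, supported in the right degree, extend to a cochain.\<close>

lemma equivariant_ext_C_As:
  assumes "\<And>\<xi>. is_gen \<xi> \<Longrightarrow> \<psi> \<xi> \<in> gen_space sU sV \<xi>"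
    and "\<And>\<xi>. is_gen \<xi> \<Longrightarrow> gen_degree \<xi> \<noteq> int m - 1 \<Longrightarrow> \<psi> \<xi> = 0"
  shows "equivariant_ext sU sV \<psi> \<in> C_As sU sV m"
  unfolding C_As_def
proof (intro CollectI conjI allI ballI impI)
  show "Vector_Spaces.linear E_scale (endo_scale sU sV) (equivariant_ext sU sV \<psi>)"
    unfolding equivariant_ext_lin_ext by (rule endo.linear_lin_ext)
next
  fix cs d and e :: "'k bimod"
  assume e: "e \<in> E_comp cs d"
  have mem: "endo_act \<sigma> (\<psi> \<xi>) \<in> End_T sU sV cs d" if "(\<xi>, \<sigma>) \<in> Poly_Mapping.keys e" for \<xi> \<sigma>
  proof -
    have "is_gen \<xi>" "\<sigma> permutes {..<arity \<xi>}"
      and cs: "cs = replicate (arity \<xi>) (in_color \<xi>)" "d = out_color \<xi>"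
      using e that by (auto simp: E_comp_def E_basis_def)
    with assms(1) have "endo_act \<sigma> (\<psi> \<xi>) \<in> gen_space sU sV \<xi>"
      unfolding gen_space_def by (intro endo_act_tensor_hom) auto
    then show ?thesis by (simp add: cs End_T_gen)
  qed
  then show "equivariant_ext sU sV \<psi> e \<in> End_T sU sV cs d"
    unfolding equivariant_ext_def
    by (intro endo.subspace_sum subspace_End_T) (auto intro: endo.subspace_scale[OF subspace_End_T])
next
  fix cs d \<tau> and e :: "'k bimod"
  assume e: "e \<in> E_comp cs d" and \<tau>: "\<tau> permutes {..<length cs}"
  let ?G = "\<lambda>(\<xi>, \<sigma>). if (\<xi>, \<sigma>) \<in> E_basis then endo_act \<sigma> (\<psi> \<xi>) else 0"
  \<comment> \<open>A component of \<open>E\<close> fixes the arity. Hence \<open>\<tau>\<close>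
    permutes the inputs of every generator that occurs in \<open>e\<close>, and
    \<open>\<sigma> \<circ> \<tau>\<close> labels a basis vector again.\<close>
  have G: "?G (\<xi>, \<sigma> \<circ> \<tau>) = endo_act \<tau> (?G (\<xi>, \<sigma>))" if "(\<xi>, \<sigma>) \<in> Poly_Mapping.keys e" for \<xi> \<sigma>
  proof -
    have *: "is_gen \<xi>" "\<sigma> permutes {..<arity \<xi>}" "\<tau> permutes {..<arity \<xi>}"
      using e that \<tau> by (auto simp: E_comp_def E_basis_def)
    then have "(\<xi>, \<sigma> \<circ> \<tau>) \<in> E_basis" "(\<xi>, \<sigma>) \<in> E_basis"
      by (auto simp: E_basis_def permutes_compose)
    then show ?thesis
      using * assms(1)[of \<xi>] unfolding gen_space_def by (simp add: endo_act_comp)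
  qed
  show "equivariant_ext sU sV \<psi> (E_act \<tau> e) = endo_act \<tau> (equivariant_ext sU sV \<psi> e)"
    unfolding equivariant_ext_lin_ext E_act_def endo.lin_ext_sum
    unfolding lin_ext_def[of _ _ e] endo_act_sum
    using G by (intro sum.cong refl) (auto simp: endo_act_scale split del: if_split)
next
  fix \<xi> \<sigma>
  assume "(\<xi>, \<sigma>) \<notin> E_basis \<or> gen_degree \<xi> \<noteq> int m - 1"
  then show "equivariant_ext sU sV \<psi> (Poly_Mapping.single (\<xi>, \<sigma>) 1) = 0"
    using assms(2)[of \<xi>] by (auto simp: equivariant_ext_lin_ext E_basis_def)
qed

lemma C_As_gen_space:
  assumes "\<theta> \<in> C_As sU sV m" "is_gen \<xi>"
  shows "\<theta> (gen_vec \<xi>) \<in> gen_space sU sV \<xi>"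
proof -
  have "gen_vec \<xi> \<in> (E_comp (replicate (arity \<xi>) (in_color \<xi>)) (out_color \<xi>) :: 'k bimod set)"
    using assms(2) by (auto simp: E_comp_def E_basis_def gen_vec_def permutes_id)
  then have "\<theta> (gen_vec \<xi>) \<in> End_T sU sV (replicate (arity \<xi>) (in_color \<xi>)) (out_color \<xi>)"
    using assms(1) by (auto simp: C_As_def)
  then show ?thesis by (simp add: End_T_gen)
qed

lemma C_As_zero:
  assumes "\<theta> \<in> C_As sU sV m" "\<not> is_gen \<xi> \<or> gen_degree \<xi> \<noteq> int m - 1"
  shows "\<theta> (gen_vec \<xi>) = 0"
  using assms by (auto simp: C_As_def gen_vec_def E_basis_def)

text \<open>Uniqueness half of freeness: the basis vector \<open>(\<xi>, \<sigma>)\<close> is the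
  generator acted on by \<open>\<sigma>\<close>, so equivariance and linearity fix the values on
  \<open>E\<close>, and a cochain is 0 on the remaining basis vectors.\<close>

lemma C_As_eq_equivariant_ext:
  assumes "\<theta> \<in> C_As sU sV m"
  shows "\<theta> = equivariant_ext sU sV (\<lambda>\<xi>. \<theta> (gen_vec \<xi>))"
proof
  fix e
  have "\<theta> (Poly_Mapping.single (\<xi>, \<sigma>) 1) = endo_act \<sigma> (\<theta> (gen_vec \<xi>))" if "(\<xi>, \<sigma>) \<in> E_basis" for \<xi> \<sigma>
  proof -
    have "gen_vec \<xi> \<in> (E_comp (replicate (arity \<xi>) (in_color \<xi>)) (out_color \<xi>) :: 'k bimod set)"
      using that by (auto simp: E_comp_def E_basis_def gen_vec_def permutes_id)
    moreover have "E_act \<sigma> (gen_vec \<xi> :: 'k bimod) = Poly_Mapping.single (\<xi>, \<sigma>) 1"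
      by (simp add: E_act_def gen_vec_def)
    moreover have "\<sigma> permutes {..<length (replicate (arity \<xi>) (in_color \<xi>))}"
      using that by (simp add: E_basis_def)
    ultimately show ?thesis
      using assms unfolding C_As_def by (metis (mono_tags, lifting) mem_Collect_eq)
  qed
  moreover have "\<theta> (Poly_Mapping.single (\<xi>, \<sigma>) 1) = 0" if "(\<xi>, \<sigma>) \<notin> E_basis" for \<xi> \<sigma>
    using assms that by (auto simp: C_As_def)
  ultimately have "(\<lambda>t. \<theta> (Poly_Mapping.single t 1)) =
      (\<lambda>(\<xi>, \<sigma>). if (\<xi>, \<sigma>) \<in> E_basis then endo_act \<sigma> (\<theta> (gen_vec \<xi>)) else 0)"
    by auto
  moreover have "\<theta> e = lin_ext (endo_scale sU sV) (\<lambda>t. \<theta> (Poly_Mapping.single t 1)) e"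
    using assms by (intro endo.linear_eq_lin_ext) (simp add: C_As_def)
  ultimately show "\<theta> e = equivariant_ext sU sV (\<lambda>\<xi>. \<theta> (gen_vec \<xi>)) e"
    by (simp add: equivariant_ext_lin_ext)
qed

end

section \<open>Composites along trees with at most two levels\<close>

lemma leaves_corolla [simp]: "leaves (corolla \<xi>) = arity \<xi>"
  by (simp add: corolla_def sum_list_replicate)

lemma vertices_corolla [simp]: "vertices (corolla \<xi>) = {[]}"
  by (simp add: corolla_def)

lemma tree_comp_corolla [simp]:
  "tree_comp \<phi> (corolla \<xi>) xs = (if length xs = arity \<xi> then \<phi> [] \<xi> xs else 0)"
proof (cases "length xs = arity \<xi>")
  case True
  let ?ts = "replicate (arity \<xi>) Leaf"
  have "map (\<lambda>i. tree_comp (\<lambda>p. \<phi> (i # p)) (?ts ! i) (segment ?ts i xs)) [0..<length ?ts] = xs"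
    using True by (intro nth_equalityI) (auto simp: segment_def sum_list_replicate hd_drop_conv_nth)
  then show ?thesis
    using True unfolding corolla_def by (simp add: sum_list_replicate del: length_replicate)
qed (simp add: corolla_def sum_list_replicate)

lemma leaves_circ:
  "s < arity \<xi> \<Longrightarrow> leaves (circ \<xi> s \<eta>) = arity \<xi> - 1 + arity \<eta>"
  by (simp add: circ_def sum_list_replicate)

lemma vertices_circ:
  assumes "s < arity \<xi>"
  shows "vertices (circ \<xi> s \<eta>) = {[], [s]}"
proof -
  let ?ts = "replicate s Leaf @ corolla \<eta> # replicate (arity \<xi> - s - 1) Leaf"
  have "(#) i ` vertices (?ts ! i) = (if i = s then {[s]} else {})" if "i < length ?ts" for i
  proof -
    have *: "?ts ! i = (if i = s then corolla \<eta> else Leaf)"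
      using that by (simp add: nth_append nth_Cons')
    show ?thesis unfolding * by simp
  qed
  then have "(\<Union>i<length ?ts. (#) i ` vertices (?ts ! i)) = (\<Union>i<length ?ts. if i = s then {[s]} else {})"
    by (intro SUP_cong) (simp_all only: lessThan_iff)
  also have "\<dots> = {[s]}"
    using assms by auto
  finally show ?thesis
    by (simp only: circ_def vertices.simps)
qed

lemma tree_comp_circ:
  assumes s: "s < arity \<xi>"
  shows "tree_comp \<phi> (circ \<xi> s \<eta>) xs =
    (if length xs = arity \<xi> - 1 + arity \<eta>
     then \<phi> [] \<xi> (take s xs @ \<phi> [s] \<eta> (take (arity \<eta>) (drop s xs)) # drop (s + arity \<eta>) xs) else 0)"
proof (cases "length xs = arity \<xi> - 1 + arity \<eta>")
  case True
  let ?ts = "replicate s Leaf @ corolla \<eta> # replicate (arity \<xi> - s - 1) Leaf"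
  have lv: "leaves (Node \<xi> ?ts) = length xs"
    using leaves_circ[OF s, of \<eta>] True by (simp add: circ_def)
  \<comment> \<open>The block of inputs of the \<open>i\<close>-th subtree begins after the leaves
    of the earlier subtrees: one leaf each up to the corolla, and beyond it one of these is replaced
    by \<open>arity \<eta>\<close> leaves.\<close>
  have off: "sum_list (map leaves (take i ?ts)) = (if i \<le> s then i else i - 1 + arity \<eta>)"
    if "i < arity \<xi>" for i
    using that s by (auto simp: take_Cons' sum_list_replicate min_def)
  have "map (\<lambda>i. tree_comp (\<lambda>p. \<phi> (i # p)) (?ts ! i) (segment ?ts i xs)) [0..<length ?ts] =
      take s xs @ \<phi> [s] \<eta> (take (arity \<eta>) (drop s xs)) # drop (s + arity \<eta>) xs" (is "?l = ?r")
  proof (rule nth_equalityI)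
    show "length ?l = length ?r" using s True by simp
    fix i assume "i < length ?l"
    then have i: "i < arity \<xi>" "i < length ?ts" using s by simp_all
    have l: "?l ! i = tree_comp (\<lambda>p. \<phi> (i # p)) (?ts ! i)
        (take (leaves (?ts ! i)) (drop (if i \<le> s then i else i - 1 + arity \<eta>) xs))"
      using i by (simp only: nth_map segment_def off length_map length_upt nth_upt minus_nat.diff_0 plus_nat.add_0)
    consider "i < s" | "i = s" | "s < i" by linarith
    then show "?l ! i = ?r ! i"
    proof cases
      case 1
      then show ?thesis unfolding l using s True i(1) by (simp add: nth_append hd_drop_conv_nth)
    next
      case 2
      then show ?thesis unfolding l using s True by (simp add: nth_append)
    next
      case 3
      then have "?ts ! i = Leaf" using i by (simp add: nth_append nth_Cons')
      moreover have "s + arity \<eta> + (i - Suc s) = i - 1 + arity \<eta>" using 3 by simp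
      ultimately show ?thesis
        unfolding l using 3 s True i(1) by (simp add: nth_append hd_drop_conv_nth nth_Cons')
    qed
  qed
  then show ?thesis
    using True lv unfolding circ_def by (simp only: tree_comp.simps if_True)
next
  case False
  then have "length xs \<noteq> leaves (circ \<xi> s \<eta>)"
    using leaves_circ[OF s] by simp
  then show ?thesis
    using False unfolding circ_def by (simp only: tree_comp.simps if_False)
qed

lemma vertices_two_level:
  "vertices (Node \<xi> (map (\<lambda>r. corolla (c r)) rs)) = insert [] ((\<lambda>k. [k]) ` {..<length rs})"
  by auto

text \<open>The condition on \<open>c\<close> turns the list of leaf counts into \<open>rs\<close>
  itself, so the \<open>k\<close>-th block of inputs begins at the \<open>k\<close>-th partial
  sum.\<close>

lemma tree_comp_two_level:
  assumes c: "\<And>r. arity (c r) = r"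
  shows "tree_comp \<phi> (Node \<xi> (map (\<lambda>r. corolla (c r)) rs)) xs =
    (if length xs = sum_list rs
     then \<phi> [] \<xi> (map (\<lambda>k. \<phi> [k] (c (rs ! k)) (take (rs ! k) (drop (sum_list (take k rs)) xs))) [0..<length rs])
     else 0)"
proof -
  let ?ts = "map (\<lambda>r. corolla (c r)) rs"
  have lv: "map leaves ?ts = rs" by (simp add: comp_def c map_idI)
  then have lv': "leaves (Node \<xi> ?ts) = sum_list rs" by simp
  have *: "tree_comp (\<lambda>p. \<phi> (k # p)) (?ts ! k) (segment ?ts k xs) =
      \<phi> [k] (c (rs ! k)) (take (rs ! k) (drop (sum_list (take k rs)) xs))"
    if k: "k < length rs" and len: "length xs = sum_list rs" for k
  proof -
    have "sum_list rs = sum_list (take k rs @ rs ! k # drop (Suc k) rs)"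
      by (simp only: id_take_nth_drop[OF k, symmetric])
    then have l: "length (take (rs ! k) (drop (sum_list (take k rs)) xs)) = rs ! k"
      using len by simp
    have "map leaves (take k ?ts) = take k rs"
      using lv by (metis take_map)
    then have "segment ?ts k xs = take (rs ! k) (drop (sum_list (take k rs)) xs)"
      using k by (simp add: segment_def c)
    then show ?thesis
      using k l by (simp add: c)
  qed
  show ?thesis
  proof (cases "length xs = sum_list rs")
    case True
    have "map (\<lambda>i. tree_comp (\<lambda>p. \<phi> (i # p)) (?ts ! i) (segment ?ts i xs)) [0..<length ?ts] =
        map (\<lambda>k. \<phi> [k] (c (rs ! k)) (take (rs ! k) (drop (sum_list (take k rs)) xs))) [0..<length rs]"
      unfolding length_map by (intro map_cong refl *) (simp_all add: True)
    then show ?thesis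
      using True by (simp only: tree_comp.simps lv' if_True)
  next
    case False
    then show ?thesis by (simp only: tree_comp.simps lv' if_False)
  qed
qed

text \<open>The Leibniz rule on a single tree, separated so that the derivation becomes the linear
  extension of it.\<close>

definition der_tree ::
  "(gen \<Rightarrow> ('u::ab_group_add, 'v::ab_group_add) endo) \<Rightarrow> (gen \<Rightarrow> ('u, 'v) endo) \<Rightarrow> tree \<Rightarrow> ('u, 'v) endo" where
  "der_tree \<beta> \<theta> t = (\<Sum>v\<in>vertices t. tree_comp (\<lambda>p \<xi>. if p = v then \<theta> \<xi> else \<beta> \<xi>) t)"

lemma der_ext_lin_ext: "der_ext sU sV \<beta> \<theta> = lin_ext (endo_scale sU sV) (der_tree \<beta> \<theta>)"
  unfolding der_ext_def lin_ext_def der_tree_def ..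

lemma der_tree_circ:
  assumes "s < arity \<xi>"
  shows "der_tree \<beta> \<theta> (circ \<xi> s \<eta>) xs =
    (if length xs = arity \<xi> - 1 + arity \<eta>
     then \<theta> \<xi> (take s xs @ \<beta> \<eta> (take (arity \<eta>) (drop s xs)) # drop (s + arity \<eta>) xs) +
       \<beta> \<xi> (take s xs @ \<theta> \<eta> (take (arity \<eta>) (drop s xs)) # drop (s + arity \<eta>) xs) else 0)"
  by (simp add: der_tree_def vertices_circ[OF assms] tree_comp_circ[OF assms])

lemma der_tree_two_level:
  assumes c: "\<And>r. arity (c r) = r"
  shows "der_tree \<beta> \<theta> (Node \<xi> (map (\<lambda>r. corolla (c r)) rs)) xs =
    (if length xs = sum_list rs
     then \<theta> \<xi> (map (\<lambda>k. \<beta> (c (rs ! k)) (take (rs ! k) (drop (sum_list (take k rs)) xs))) [0..<length rs]) +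
       (\<Sum>v<length rs. \<beta> \<xi> (map (\<lambda>k. (if k = v then \<theta> (c (rs ! k)) else \<beta> (c (rs ! k)))
          (take (rs ! k) (drop (sum_list (take k rs)) xs))) [0..<length rs]))
     else 0)"
proof -
  have "der_tree \<beta> \<theta> (Node \<xi> (map (\<lambda>r. corolla (c r)) rs)) xs =
      (\<Sum>v\<in>insert [] ((\<lambda>k. [k]) ` {..<length rs}).
        tree_comp (\<lambda>p \<xi>. if p = v then \<theta> \<xi> else \<beta> \<xi>) (Node \<xi> (map (\<lambda>r. corolla (c r)) rs)) xs)"
    unfolding der_tree_def vertices_two_level sum_fun_apply ..
  also have "\<dots> = tree_comp (\<lambda>p \<xi>. if p = [] then \<theta> \<xi> else \<beta> \<xi>) (Node \<xi> (map (\<lambda>r. corolla (c r)) rs)) xs +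
      (\<Sum>v<length rs. tree_comp (\<lambda>p \<xi>. if p = [v] then \<theta> \<xi> else \<beta> \<xi>) (Node \<xi> (map (\<lambda>r. corolla (c r)) rs)) xs)"
    by (subst sum.insert) (auto simp: sum.reindex inj_on_def simp del: tree_comp.simps)
  finally show ?thesis
    unfolding tree_comp_two_level[OF c] by simp
qed

lemma sum_eq_single:
  assumes "finite S" "\<And>x. x \<in> S \<Longrightarrow> x \<noteq> a \<Longrightarrow> f x = 0"
  shows "sum f S = (if a \<in> S then f a else 0)"
  using sum.mono_neutral_right[of S "S \<inter> {a}" f] assms by (auto split: if_splits)

lemma finite_compositions: "finite (compositions l n)"
proof (rule finite_subset)
  show "compositions l n \<subseteq> {rs. set rs \<subseteq> {..n} \<and> length rs = l}"
    using member_le_sum_list by (auto simp: compositions_def)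
qed (simp add: finite_lists_length_eq)

text \<open>Adapts the exponent \<open>s * (j + 1)\<close> of the boundary to \<open>j = 2\<close>,
  where 3 has the parity of 1.\<close>

lemma neg_one_power_3: "(-1 :: 'k::comm_ring_1) ^ (p + s * 3) = (-1) ^ (p + s)"
  by (simp add: power_add power_mult mult.commute[of s] minus_one_power_iff)

section \<open>The terms of the boundary that survive evaluation\<close>

context algebra_morphism
begin

text \<open>Here \<open>C\<close> decorates the root and \<open>C'\<close> the upper vertex. The
  surviving index pairs are \<open>(p, 2)\<close> and \<open>(a, q)\<close>, and
  \<open>p + 2 = a + q\<close> says that both occur for the same arity \<open>N = p + 1\<close>. The
  instances are \<open>a = 2\<close>, \<open>p = q = n\<close> for the two families of products and
  \<open>a = 1\<close>, \<open>p = n - 1\<close>, \<open>q = n\<close> for the family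
  \<open>Fg\<close>.\<close>

lemma der_ext_circ_sum:
  assumes arity: "\<And>i. arity (C i) = i" "\<And>i. arity (C' i) = i"
    and apq: "1 \<le> a" "a \<le> p" "p + 2 = a + q"
    and \<theta>: "\<And>i. i \<noteq> p \<Longrightarrow> \<theta> (C i) = 0" "\<And>i. i \<noteq> q \<Longrightarrow> \<theta> (C' i) = 0"
    and \<beta>: "\<And>i. i \<noteq> a \<Longrightarrow> \<beta> (C i) = 0" "\<And>i. i \<noteq> 2 \<Longrightarrow> \<beta> (C' i) = 0"
    and zero: "\<And>i ys. 0 \<in> set ys \<Longrightarrow> i \<ge> a \<Longrightarrow> \<theta> (C i) ys = 0" "\<And>i ys. 0 \<in> set ys \<Longrightarrow> \<beta> (C i) ys = 0"
  shows "der_ext sU sV \<beta> \<theta> (\<Sum>(i, j)\<in>{(i, j). i + j = N + 1 \<and> i \<ge> a \<and> j \<ge> 2}. \<Sum>s=0..N - j.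
      Poly_Mapping.single (circ (C i) s (C' j)) ((-1) ^ (i + s * (j + 1)))) xs =
    (if length xs = N \<and> N = p + 1 then
      (\<Sum>s<p. T.scale ((-1) ^ (p + s)) (\<theta> (C p) (take s xs @ \<beta> (C' 2) (take 2 (drop s xs)) # drop (s + 2) xs))) +
      (\<Sum>s<a. T.scale ((-1) ^ (a + s * (q + 1)))
        (\<beta> (C a) (take s xs @ \<theta> (C' q) (take q (drop s xs)) # drop (s + q) xs)))
     else 0)"
proof -
  let ?S = "{(i, j). i + j = N + 1 \<and> i \<ge> a \<and> j \<ge> 2}"
  \<comment> \<open>\<open>P\<close> has the derivation at the root, \<open>Q\<close> at the upper
    vertex. The surviving pairs coincide when \<open>p = a\<close>, so each part is reduced on its
    own.\<close>
  define P where "P = (\<lambda>(i, j). \<Sum>s=0..N - j. T.scale ((-1) ^ (i + s * (j + 1)))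
    (\<theta> (C i) (take s xs @ \<beta> (C' j) (take j (drop s xs)) # drop (s + j) xs)))"
  define Q where "Q = (\<lambda>(i, j). \<Sum>s=0..N - j. T.scale ((-1) ^ (i + s * (j + 1)))
    (\<beta> (C i) (take s xs @ \<theta> (C' j) (take j (drop s xs)) # drop (s + j) xs)))"
  have fin: "finite ?S"
    by (rule finite_subset[of _ "{..N + 1} \<times> {..N + 1}"]) auto
  have "der_ext sU sV \<beta> \<theta> (\<Sum>(i, j)\<in>?S. \<Sum>s=0..N - j.
      Poly_Mapping.single (circ (C i) s (C' j)) ((-1) ^ (i + s * (j + 1)))) xs =
    (\<Sum>(i, j)\<in>?S. \<Sum>s=0..N - j. T.scale ((-1) ^ (i + s * (j + 1))) (der_tree \<beta> \<theta> (circ (C i) s (C' j)) xs))"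
    by (simp add: der_ext_lin_ext endo.lin_ext_sum sum_fun_apply fun_scale_def split_def)
  also have "\<dots> = (\<Sum>ij\<in>?S. if length xs = N then P ij + Q ij else 0)"
  proof (rule sum.cong)
    fix ij assume "ij \<in> ?S"
    then obtain i j where ij: "ij = (i, j)" "i + j = N + 1" "i \<ge> a" "j \<ge> 2" by auto
    have "s < i" if "s \<le> N - j" for s using that ij apq by linarith
    moreover have "i - Suc 0 + j = N" using ij apq by linarith
    ultimately show "(case ij of (i, j) \<Rightarrow> \<Sum>s=0..N - j. T.scale ((-1) ^ (i + s * (j + 1)))
        (der_tree \<beta> \<theta> (circ (C i) s (C' j)) xs)) = (if length xs = N then P ij + Q ij else 0)"
      by (simp add: ij(1) P_def Q_def arity der_tree_circ T.p.scale_right_distrib sum.distrib)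
  qed simp
  also have "\<dots> = (if length xs = N then sum P ?S + sum Q ?S else 0)"
    by (simp add: sum.distrib)
  also have "sum P ?S = (if (p, 2) \<in> ?S then P (p, 2) else 0)"
  proof (rule sum_eq_single[OF fin])
    fix ij assume "ij \<in> ?S" "ij \<noteq> (p, 2)"
    then obtain i j where ij: "ij = (i, j)" "i \<ge> a" "i \<noteq> p \<or> j \<noteq> 2" by (cases ij) auto
    have "\<theta> (C i) (take s xs @ \<beta> (C' j) ys # zs) = 0" for s ys zs
      using \<theta>(1)[of i] \<beta>(2)[of j] zero(1)[of "take s xs @ 0 # zs" i] ij(2,3) by (cases "i = p") simp_all
    then show "P ij = 0" by (simp add: ij(1) P_def)
  qed
  also have "(if (p, 2) \<in> ?S then P (p, 2) else 0) =
    (if N = p + 1 then \<Sum>s<p. T.scale ((-1) ^ (p + s))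
      (\<theta> (C p) (take s xs @ \<beta> (C' 2) (take 2 (drop s xs)) # drop (s + 2) xs)) else 0)"
  proof -
    have iff: "(p, 2) \<in> ?S \<longleftrightarrow> N = p + 1" using apq by auto
    show ?thesis
    proof (cases "N = p + 1")
      case True
      then have "{0..N - 2} = {..<p}" using apq by auto
      then have "P (p, 2) = (\<Sum>s<p. T.scale ((-1) ^ (p + s))
          (\<theta> (C p) (take s xs @ \<beta> (C' 2) (take 2 (drop s xs)) # drop (s + 2) xs)))"
        unfolding P_def prod.case by (intro sum.cong) (simp_all add: neg_one_power_3)
      then show ?thesis using True iff by (simp only: if_True)
    next
      case False
      then show ?thesis using iff by (simp only: if_False)
    qed
  qed
  also have "sum Q ?S = (if (a, q) \<in> ?S then Q (a, q) else 0)"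
  proof (rule sum_eq_single[OF fin])
    fix ij assume "ij \<in> ?S" "ij \<noteq> (a, q)"
    then obtain i j where ij: "ij = (i, j)" "i \<noteq> a \<or> j \<noteq> q" by (cases ij) auto
    have "\<beta> (C i) (take s xs @ \<theta> (C' j) ys # zs) = 0" for s ys zs
      using \<beta>(1)[of i] \<theta>(2)[of j] zero(2)[of "take s xs @ 0 # zs" i] ij(2) by (cases "i = a") simp_all
    then show "Q ij = 0" by (simp add: ij(1) Q_def)
  qed
  also have "(if (a, q) \<in> ?S then Q (a, q) else 0) =
    (if N = p + 1 then \<Sum>s<a. T.scale ((-1) ^ (a + s * (q + 1)))
      (\<beta> (C a) (take s xs @ \<theta> (C' q) (take q (drop s xs)) # drop (s + q) xs)) else 0)"
  proof -
    have iff: "(a, q) \<in> ?S \<longleftrightarrow> N = p + 1" using apq by auto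
    show ?thesis
    proof (cases "N = p + 1")
      case True
      then have "{0..N - q} = {..<a}" using apq by auto
      then have "Q (a, q) = (\<Sum>s<a. T.scale ((-1) ^ (a + s * (q + 1)))
          (\<beta> (C a) (take s xs @ \<theta> (C' q) (take q (drop s xs)) # drop (s + q) xs)))"
        unfolding Q_def prod.case by (intro sum.cong) simp_all
      then show ?thesis using True iff by (simp only: if_True)
    next
      case False
      then show ?thesis using iff by (simp only: if_False)
    qed
  qed
  finally show ?thesis by (auto split: if_split)
qed


text \<open>With the derivation at the root all upper vertices must be \<open>Fg 1\<close>, so the
  composition consists of ones. With it at an upper vertex the root must be \<open>Nu 2\<close> and
  the other upper vertex \<open>Fg 1\<close>, which leaves \<open>[n - 1, 1]\<close> and
  \<open>[1, n - 1]\<close>. Each of these has total arity \<open>n\<close>.\<close>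

lemma der_ext_composition_sum:
  assumes "2 \<le> n"
    and \<theta>: "\<And>i. i \<noteq> n \<Longrightarrow> \<theta> (Nu i) = 0" "\<And>i. i + 1 \<noteq> n \<Longrightarrow> \<theta> (Fg i) = 0"
    and \<beta>: "\<And>i. i \<noteq> 2 \<Longrightarrow> \<beta> (Nu i) = 0" "\<And>i. i \<noteq> 1 \<Longrightarrow> \<beta> (Fg i) = 0"
    and zero: "\<And>i ys. 0 \<in> set ys \<Longrightarrow> i \<ge> 2 \<Longrightarrow> \<theta> (Nu i) ys = 0" "\<And>i ys. 0 \<in> set ys \<Longrightarrow> \<beta> (Nu i) ys = 0"
  shows "der_ext sU sV \<beta> \<theta> (\<Sum>l=2..N. \<Sum>rs\<in>compositions l N.
      Poly_Mapping.single (Node (Nu l) (map (\<lambda>r. corolla (Fg r)) rs))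
        ((-1) ^ (\<Sum>j<l. \<Sum>i<j. rs ! i * (rs ! j + 1)))) xs =
    (if length xs = N \<and> N = n then
      \<theta> (Nu n) (map (\<lambda>x. \<beta> (Fg 1) [x]) xs) +
      T.scale ((-1) ^ n) (\<beta> (Nu 2) [\<beta> (Fg 1) (take 1 xs), \<theta> (Fg (n - 1)) (drop 1 xs)]) +
      \<beta> (Nu 2) [\<theta> (Fg (n - 1)) (take (n - 1) xs), \<beta> (Fg 1) (drop (n - 1) xs)]
     else 0)" (is "?lhs = ?rhs")
proof -
  define sg :: "nat list \<Rightarrow> 'k" where "sg = (\<lambda>rs. (-1) ^ (\<Sum>j<length rs. \<Sum>i<j. rs ! i * (rs ! j + 1)))"
  define seg where "seg = (\<lambda>rs k. take (rs ! k) (drop (sum_list (take k rs)) xs))"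
  define P where "P = (\<lambda>rs. \<theta> (Nu (length rs)) (map (\<lambda>k. \<beta> (Fg (rs ! k)) (seg rs k)) [0..<length rs]))"
  define Q where "Q = (\<lambda>rs. \<Sum>v<length rs. \<beta> (Nu (length rs))
    (map (\<lambda>k. (if k = v then \<theta> (Fg (rs ! k)) else \<beta> (Fg (rs ! k))) (seg rs k)) [0..<length rs]))"
  have "?lhs = (\<Sum>l=2..N. \<Sum>rs\<in>compositions l N. T.scale (sg rs)
      (der_tree \<beta> \<theta> (Node (Nu (length rs)) (map (\<lambda>r. corolla (Fg r)) rs)) xs))"
    by (simp add: der_ext_lin_ext endo.lin_ext_sum sum_fun_apply fun_scale_def sg_def compositions_def)
  also have "\<dots> = (\<Sum>l=2..N. \<Sum>rs\<in>compositions l N. if length xs = N then T.scale (sg rs) (P rs + Q rs) else 0)"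
  proof (intro sum.cong refl)
    fix l rs assume "rs \<in> compositions l N"
    then show "T.scale (sg rs) (der_tree \<beta> \<theta> (Node (Nu (length rs)) (map (\<lambda>r. corolla (Fg r)) rs)) xs) =
        (if length xs = N then T.scale (sg rs) (P rs + Q rs) else 0)"
      by (subst der_tree_two_level) (auto simp: compositions_def P_def Q_def seg_def)
  qed
  also have "\<dots> = (if length xs = N then
      (\<Sum>l=2..N. \<Sum>rs\<in>compositions l N. T.scale (sg rs) (P rs)) +
      (\<Sum>l=2..N. \<Sum>rs\<in>compositions l N. T.scale (sg rs) (Q rs)) else 0)"
    by (simp add: T.p.scale_right_distrib sum.distrib)
  also have "\<dots> = ?rhs"
  proof (cases "length xs = N")
    case len: True
    have P0: "P rs = 0" if rs: "rs \<in> compositions l N" "2 \<le> l" "l \<noteq> n \<or> rs \<noteq> replicate n 1" for l rs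
    proof (cases "l = n")
      case True
      with rs obtain k where k: "k < length rs" "rs ! k \<noteq> 1"
        by (metis (mono_tags, lifting) compositions_def mem_Collect_eq in_set_conv_nth replicate_eqI)
      then have "\<beta> (Fg (rs ! k)) (seg rs k) = 0" by (simp add: \<beta>(2))
      then have "0 \<in> set (map (\<lambda>k. \<beta> (Fg (rs ! k)) (seg rs k)) [0..<length rs])"
        using k(1) by force
      then show ?thesis using rs by (simp add: P_def compositions_def zero(1))
    next
      case False
      then show ?thesis using rs by (simp add: P_def compositions_def \<theta>(1))
    qed
    have "(\<Sum>l=2..N. \<Sum>rs\<in>compositions l N. T.scale (sg rs) (P rs)) =
        (if n \<in> {2..N} then \<Sum>rs\<in>compositions n N. T.scale (sg rs) (P rs) else 0)"
      using P0 by (intro sum_eq_single sum.neutral ballI finite_atLeastAtMost) simp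
    also have "(\<Sum>rs\<in>compositions n N. T.scale (sg rs) (P rs)) =
        (if replicate n 1 \<in> compositions n N then T.scale (sg (replicate n 1)) (P (replicate n 1)) else 0)"
      using P0 assms(1) by (intro sum_eq_single finite_compositions) simp
    also have "(if n \<in> {2..N} then \<dots> else 0) =
        (if N = n then \<theta> (Nu n) (map (\<lambda>x. \<beta> (Fg 1) [x]) xs) else 0)"
    proof (cases "N = n")
      case True
      \<comment> \<open>Every contribution to the exponent is \<open>1 * (1 + 1)\<close>, so this
        composition has sign \<open>+1\<close>.\<close>
      have "even (\<Sum>j<n. \<Sum>i<j. replicate n 1 ! i * (replicate n 1 ! j + 1) :: nat)"
        by (intro dvd_sum) simp
      then have "sg (replicate n 1) = 1" by (simp add: sg_def)
      moreover have "map (\<lambda>k. \<beta> (Fg (replicate n 1 ! k)) (seg (replicate n 1) k)) [0..<n] =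
          map (\<lambda>x. \<beta> (Fg 1) [x]) xs"
        using len True
        by (intro nth_equalityI) (auto simp: seg_def sum_list_replicate take_Suc hd_drop_conv_nth)
      ultimately show ?thesis
        using True assms(1) by (simp add: P_def compositions_def sum_list_replicate)
    next
      case False
      then show ?thesis by (simp add: compositions_def sum_list_replicate)
    qed
    finally have P: "(\<Sum>l=2..N. \<Sum>rs\<in>compositions l N. T.scale (sg rs) (P rs)) =
        (if N = n then \<theta> (Nu n) (map (\<lambda>x. \<beta> (Fg 1) [x]) xs) else 0)" .
    \<comment> \<open>For \<open>n = 2\<close> the two surviving compositions are the same list
      \<open>[1, 1]\<close>. The two Leibniz summands are separated so that each is reduced to one
      composition.\<close>
    let ?L = "\<lambda>rs. \<beta> (Nu 2) [\<theta> (Fg (rs ! 0)) (seg rs 0), \<beta> (Fg (rs ! 1)) (seg rs 1)]"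
    let ?R = "\<lambda>rs. \<beta> (Nu 2) [\<beta> (Fg (rs ! 0)) (seg rs 0), \<theta> (Fg (rs ! 1)) (seg rs 1)]"
    have comp2: "rs \<in> compositions 2 N \<longleftrightarrow> (\<exists>r r'. rs = [r, r'] \<and> r + r' = N \<and> r \<ge> 1 \<and> r' \<ge> 1)" for rs
      by (auto simp: compositions_def numeral_2_eq_2 length_Suc_conv)
    have Q2: "Q rs = ?L rs + ?R rs" if "rs \<in> compositions 2 N" for rs
    proof -
      have "length rs = 2" "[0..<2] = [0, 1]" "{..<2} = {0, 1 :: nat}"
        using that by (auto simp: compositions_def upt_rec)
      then show ?thesis by (simp add: Q_def)
    qed
    have sg2: "sg [r, r'] = (-1) ^ (r * (r' + 1))" for r r'
      by (simp add: sg_def lessThan_Suc)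
    have "(\<Sum>l=2..N. \<Sum>rs\<in>compositions l N. T.scale (sg rs) (Q rs)) =
        (if 2 \<in> {2..N} then \<Sum>rs\<in>compositions 2 N. T.scale (sg rs) (Q rs) else 0)"
      using \<beta>(1) by (intro sum_eq_single sum.neutral ballI finite_atLeastAtMost) (simp add: Q_def compositions_def)
    also have "\<dots> = (\<Sum>rs\<in>compositions 2 N. T.scale (sg rs) (Q rs))"
    proof -
      have "compositions 2 N = {}" if "\<not> 2 \<le> N" using that by (auto simp: comp2)
      then show ?thesis by (cases "2 \<le> N") simp_all
    qed
    also have "\<dots> = (\<Sum>rs\<in>compositions 2 N. T.scale (sg rs) (?L rs)) + (\<Sum>rs\<in>compositions 2 N. T.scale (sg rs) (?R rs))"
      unfolding sum.distrib[symmetric]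
      by (intro sum.cong refl) (simp only: Q2 T.p.scale_right_distrib)
    also have "(\<Sum>rs\<in>compositions 2 N. T.scale (sg rs) (?L rs)) =
        (if [n - 1, 1] \<in> compositions 2 N then T.scale (sg [n - 1, 1]) (?L [n - 1, 1]) else 0)"
    proof (intro sum_eq_single finite_compositions)
      fix rs assume rs: "rs \<in> compositions 2 N" "rs \<noteq> [n - 1, 1]"
      then obtain r r' where r: "rs = [r, r']" by (auto simp: comp2)
      with rs(2) have "r + 1 \<noteq> n \<or> r' \<noteq> 1" by auto
      then have "?L rs = 0"
        using r \<theta>(2)[of r] \<beta>(2)[of r'] by (intro zero(2)) auto
      then show "T.scale (sg rs) (?L rs) = 0" by simp
    qed
    also have "\<dots> = (if N = n then \<beta> (Nu 2) [\<theta> (Fg (n - 1)) (take (n - 1) xs), \<beta> (Fg 1) (drop (n - 1) xs)] else 0)"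
    proof -
      have "[n - 1, 1] \<in> compositions 2 N \<longleftrightarrow> N = n" using assms(1) by (auto simp: compositions_def)
      moreover have "seg [n - 1, 1] 0 = take (n - 1) xs" by (simp add: seg_def)
      moreover have "seg [n - 1, 1] 1 = drop (n - 1) xs" if "N = n" using that len by (simp add: seg_def)
      moreover have "sg [n - 1, 1] = 1" by (simp add: sg2 power_mult[symmetric])
      ultimately show ?thesis by simp
    qed
    also have "(\<Sum>rs\<in>compositions 2 N. T.scale (sg rs) (?R rs)) =
        (if [1, n - 1] \<in> compositions 2 N then T.scale (sg [1, n - 1]) (?R [1, n - 1]) else 0)"
    proof (intro sum_eq_single finite_compositions)
      fix rs assume rs: "rs \<in> compositions 2 N" "rs \<noteq> [1, n - 1]"
      then obtain r r' where r: "rs = [r, r']" by (auto simp: comp2)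
      with rs(2) have "r' + 1 \<noteq> n \<or> r \<noteq> 1" by auto
      then have "?R rs = 0"
        using r \<theta>(2)[of r'] \<beta>(2)[of r] by (intro zero(2)) auto
      then show "T.scale (sg rs) (?R rs) = 0" by simp
    qed
    also have "\<dots> = (if N = n then
        T.scale ((-1) ^ n) (\<beta> (Nu 2) [\<beta> (Fg 1) (take 1 xs), \<theta> (Fg (n - 1)) (drop 1 xs)]) else 0)"
    proof -
      have "[1, n - 1] \<in> compositions 2 N \<longleftrightarrow> N = n" using assms(1) by (auto simp: compositions_def)
      moreover have "seg [1, n - 1] 0 = take 1 xs" by (simp add: seg_def)
      moreover have "seg [1, n - 1] 1 = drop 1 xs" if "N = n" using that len by (simp add: seg_def)
      \<comment> \<open>The exponent is \<open>1 * ((n - 1) + 1) = n\<close>; for the other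
        composition it is the even number \<open>(n - 1) * 2\<close>.\<close>
      moreover have "sg [1, n - 1] = (-1) ^ n" using assms(1) by (simp add: sg2)
      ultimately show ?thesis by simp
    qed
    finally show ?thesis
      using len P by (simp add: add.assoc add.commute)
  qed simp
  finally show ?thesis .
qed

end

section \<open>The differential in terms of Hochschild cochains\<close>

text \<open>The inner sum is reindexed by \<open>i = s + 1\<close> to match the insertion positions
  in the boundary, which start at 0; this shift produces the minus sign.\<close>

lemma (in vector_space) hochschild_contract:
  assumes "length as = n + 1"
  shows "hochschild scale l r n \<phi> as =
    l (hd as) (\<phi> (tl as)) - (\<Sum>s<n. scale ((-1) ^ s) (\<phi> (contract s as)))
    + scale ((-1) ^ (n + 1)) (r (\<phi> (butlast as)) (last as))"
proof -
  have "(\<Sum>i=1..n. scale ((-1) ^ i) (\<phi> (take (i - 1) as @ [as ! (i - 1) * as ! i] @ drop (i + 1) as))) =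
      (\<Sum>s<n. - scale ((-1) ^ s) (\<phi> (contract s as)))"
    unfolding One_nat_def sum.atLeast1_atMost_eq using assms
    by (intro sum.cong refl) (simp add: contract_eq)
  then show ?thesis
    using assms by (simp add: hochschild_def sum_negf)
qed

text \<open>An entry outside \<open>W\<close> either lies in the block handed to \<open>G\<close>,
  which then returns 0 and puts a zero entry into the argument of \<open>F\<close>, or it remains as
  an argument of \<open>F\<close> itself.\<close>

lemma splice_zero:
  assumes "\<not> set xs \<subseteq> W"
    and "\<And>ys. \<not> set ys \<subseteq> W \<Longrightarrow> F ys = 0" "\<And>ys. 0 \<in> set ys \<Longrightarrow> F ys = 0"
    and "\<And>ys. \<not> set ys \<subseteq> W \<Longrightarrow> G ys = 0"
  shows "F (take s xs @ G (take k (drop s xs)) # drop (s + k) xs) = 0"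
proof (cases "set (take k (drop s xs)) \<subseteq> W")
  case True
  have "take s xs @ take k (drop s xs) @ drop (s + k) xs = xs"
    unfolding add.commute[of s k] drop_drop[symmetric] append_take_drop_id ..
  from arg_cong[OF this, of set] have "set xs = set (take s xs) \<union> set (take k (drop s xs)) \<union> set (drop (s + k) xs)"
    by (simp add: Un_assoc)
  then have "\<not> set (take s xs @ G (take k (drop s xs)) # drop (s + k) xs) \<subseteq> W"
    using True assms(1) by auto
  then show ?thesis by (rule assms(2))
next
  case False
  then show ?thesis by (intro assms(3)) (simp add: assms(4))
qed

text \<open>On lists over the summand, inserting the product of two neighbours is
  \<open>contract\<close>; on all other lists both sides are 0 by \<open>splice_zero\<close>. The
  target summand may differ from the source, so that the case of \<open>Fg\<close> is covered
  too.\<close>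

lemma inner_products:
  fixes sA :: "'k::field \<Rightarrow> 'a::ring \<Rightarrow> 'a"
  assumes "summand_pair sA sT e p sM sT' e' p'" and F: "F \<in> hom_pow sA sM m" and len: "length xs = m + 1"
    and M: "\<And>a b. M [e a, e b] = e (a * b)" "\<And>ys. \<not> set ys \<subseteq> range e \<Longrightarrow> M ys = 0"
  shows "(\<Sum>s<m. sT' ((-1) ^ (m + s)) (transport e p e' F (take s xs @ M (take 2 (drop s xs)) # drop (s + 2) xs))) =
    transport e p e' (\<lambda>as. \<Sum>s<m. sM ((-1) ^ (m + s)) (F (contract s as))) xs"
proof -
  interpret summand_pair sA sT e p sM sT' e' p' by fact
  show ?thesis
  proof (cases "set xs \<subseteq> range e")
    case True
    obtain as where as: "xs = map e as"
      using src.map_e_map_p[OF True] by (rule that[OF sym])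
    have "take s xs @ M (take 2 (drop s xs)) # drop (s + 2) xs = map e (contract s as)" if "s < m" for s
    proof -
      have "take 2 (drop s as) = [as ! s, as ! Suc s]"
        using that len as by (intro nth_equalityI) (auto simp: less_Suc_eq numeral_2_eq_2)
      then show ?thesis
        using that len M(1) by (simp add: as contract_eq take_map drop_map)
    qed
    moreover have "set (map e ys) \<subseteq> range e" for ys by auto
    ultimately show ?thesis
      by (simp add: as transport_def tgt.e.sum tgt.e.scale del: set_map map_map)
  next
    case False
    have "transport e p e' F (take s xs @ M (take 2 (drop s xs)) # drop (s + 2) xs) = 0" for s
      by (rule splice_zero[where W = "range e", OF False _ tensor_hom_zero_entry[OF transport_tensor_hom[OF F]] M(2)])
        (simp add: transport_def)
    then show ?thesis using False by (simp add: transport_def)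
  qed
qed

text \<open>The position \<open>s = 0\<close> leaves the last entry as a right factor with sign
  \<open>+1\<close>, and \<open>s = 1\<close> leaves the first entry as a left factor with sign
  \<open>(-1) ^ (n + 1)\<close>.\<close>

lemma outer_products:
  fixes sA :: "'k::field \<Rightarrow> 'a::ring \<Rightarrow> 'a"
  assumes "summand sA sT e p" and len: "length xs = n + 1"
    and M: "\<And>a b. M [e a, e b] = e (a * b)" "\<And>ys. \<not> set ys \<subseteq> range e \<Longrightarrow> M ys = 0"
    "\<And>ys. 0 \<in> set ys \<Longrightarrow> M ys = 0"
  shows "(\<Sum>s<2. sT ((-1) ^ (2 + s * (n + 1))) (M (take s xs @ transport e p e F (take n (drop s xs)) # drop (s + n) xs))) =
    transport e p e (\<lambda>as. F (butlast as) * last as + sA ((-1) ^ (n + 1)) (hd as * F (tl as))) xs"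
proof -
  interpret summand sA sT e p by fact
  show ?thesis
  proof (cases "set xs \<subseteq> range e")
    case True
    obtain as where as: "xs = map e as"
      using map_e_map_p[OF True] by (rule that[OF sym])
    have last: "take n as = butlast as" "drop n as = [last as]"
      using len as by (cases as rule: rev_cases; simp)+
    have first: "take (Suc 0) as = [hd as]" "drop (Suc 0) as = tl as" "take n (tl as) = tl as" "drop (Suc n) as = []"
      using len as by (cases as; simp)+
    have "set (map e ys) \<subseteq> range e" for ys by auto
    then show ?thesis
      using first last M(1) by (simp add: as transport_def numeral_2_eq_2 take_map drop_map e.add e.diff e.scale del: set_map map_map)
  next
    case False
    have "M (take s xs @ transport e p e F (take n (drop s xs)) # drop (s + n) xs) = 0" for s
      by (rule splice_zero[where W = "range e", OF False M(2,3)]) (simp_all add: transport_def)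
    then show ?thesis using False by (simp add: transport_def)
  qed
qed

context algebra_morphism
begin

text \<open>The three coefficient bimodules of the complex: each algebra over itself, and the target
  over the source along \<open>g\<close>.\<close>

sublocale self_U: bimodule sU sU "(*)" "(*)"
  by unfold_locales (auto simp: algebra_simps source.scale_mult_left source.scale_mult_right)

sublocale self_V: bimodule sV sV "(*)" "(*)"
  by unfold_locales (auto simp: algebra_simps target.scale_mult_left target.scale_mult_right)

sublocale via: bimodule sU sV "\<lambda>u v. g u * v" "\<lambda>v u. v * g u"
  by unfold_locales
    (auto simp: algebra_simps target.scale_mult_left target.scale_mult_right add scale map_mult)

lemma beta_simps:
  "beta g (Mu 2) [inB a, inB b] = inB (a * b)"
  "beta g (Nu 2) [inW c, inW d] = inW (c * d)"
  "beta g (Fg 1) [inB a] = inW (g a)"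
  by (auto simp: beta_def inB_def inW_def T_part_def numeral_2_eq_2)

lemma beta_eq_0:
  "i \<noteq> 2 \<Longrightarrow> beta g (Mu i) = 0" "i \<noteq> 2 \<Longrightarrow> beta g (Nu i) = 0" "i \<noteq> 1 \<Longrightarrow> beta g (Fg i) = 0"
  by (auto simp: beta_def fun_eq_iff)

lemma beta_outside:
  assumes "\<not> set ys \<subseteq> T_part (in_color \<xi>)"
  shows "beta g \<xi> ys = 0"
proof -
  have "\<not> list_all2 (\<lambda>x c. x \<in> T_part c) ys (replicate (arity \<xi>) (in_color \<xi>))"
  proof
    assume "list_all2 (\<lambda>x c. x \<in> T_part c) ys (replicate (arity \<xi>) (in_color \<xi>))"
    then have "ys ! i \<in> T_part (in_color \<xi>)" if "i < length ys" for i
      using that by (auto simp: list_all2_conv_all_nth)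
    with assms show False by (metis in_set_conv_nth subsetI)
  qed
  then show ?thesis by (simp add: beta_def)
qed

text \<open>Checked on the three operations that \<open>beta\<close> does not send to 0: a product
  with a factor 0 vanishes, and \<open>g\<close> preserves 0.\<close>

lemma beta_zero_entry:
  assumes "0 \<in> set ys"
  shows "beta g \<xi> ys = 0"
proof (cases "list_all2 (\<lambda>x c. x \<in> T_part c) ys (replicate (arity \<xi>) (in_color \<xi>))")
  case True
  then have len: "length ys = arity \<xi>" by (auto dest: list_all2_lengthD)
  obtain i where "i < length ys" "ys ! i = 0" using assms by (auto simp: in_set_conv_nth)
  then show ?thesis
    using len by (auto simp: beta_def numeral_2_eq_2 less_Suc_eq inB_def inW_def zero_prod_def)
qed (simp add: beta_def)

end

lemma (in vector_space) scale_sign_sign [simp]: "scale ((-1) ^ k) (scale ((-1) ^ k) x) = x"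
  by (simp flip: power_mult_distrib)

lemma (in vector_space) sum_sign_shift:
  "(\<Sum>s\<in>S. scale ((-1) ^ (n + s)) (c s)) = scale ((-1) ^ n) (\<Sum>s\<in>S. scale ((-1) ^ s) (c s))"
  by (simp add: scale_sum_right power_add)

lemma (in summand_pair) transport_add:
  "transport e p e' F xs + transport e p e' G xs = transport e p e' (\<lambda>as. F as + G as) xs"
  by (simp add: transport_def tgt.e.add)

lemma (in summand_pair) transport_uminus:
  "- transport e p e' F xs = transport e p e' (\<lambda>as. - F as) xs"
  by (simp add: transport_def tgt.e.neg)

lemma transport_cong: "F (map p xs) = G (map p xs) \<Longrightarrow> transport e p e' F xs = transport e p e' G xs"
  by (simp add: transport_def)

section \<open>Values of the differential on generators\<close>

context algebra_morphism
begin

text \<open>The Hochschild differential has sign \<open>+1\<close> on the left multiplication and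
  \<open>(-1) ^ (n + 1)\<close> on the right one, whereas the boundary has these signs interchanged.
  Factoring out \<open>(-1) ^ (n + 1)\<close> corrects this and turns the inner signs
  \<open>(-1) ^ (n + s)\<close> into \<open>- (-1) ^ s\<close>.\<close>

lemma der_ext_self:
  fixes sA :: "'k \<Rightarrow> 'a::ring \<Rightarrow> 'a"
  assumes "summand sA (T_scale sU sV) e p" and F: "F \<in> hom_pow sA sA n" and n: "2 \<le> n"
    and arity: "\<And>i. arity (C i) = i"
    and A: "A (C n) = transport e p e F" "\<And>i. i \<noteq> n \<Longrightarrow> A (C i) = 0"
    and M: "\<And>a b. beta g (C 2) [e a, e b] = e (a * b)"
      "\<And>ys. \<not> set ys \<subseteq> range e \<Longrightarrow> beta g (C 2) ys = 0" "\<And>i. i \<noteq> 2 \<Longrightarrow> beta g (C i) = 0"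
  shows "der_ext sU sV (beta g) A (\<Sum>(i, j)\<in>{(i, j). i + j = N + 1 \<and> i \<ge> 2 \<and> j \<ge> 2}. \<Sum>s=0..N - j.
      Poly_Mapping.single (circ (C i) s (C j)) ((-1) ^ (i + s * (j + 1)))) =
    (if N = n + 1 then transport e p e (\<lambda>as. sA ((-1) ^ (n + 1)) (b_self sA n F as)) else 0)"
    (is "?l = ?r")
proof
  interpret summand sA "T_scale sU sV" e p by fact
  interpret pair: summand_pair sA "T_scale sU sV" e p sA "T_scale sU sV" e p by unfold_locales
  fix xs
  have Az: "A (C i) ys = 0" if "0 \<in> set ys" for i ys
    using A tensor_hom_zero_entry[OF pair.transport_tensor_hom[OF F] that] by (cases "i = n") simp_all
  have *: "?l xs = (if length xs = N \<and> N = n + 1 then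
      (\<Sum>s<n. T.scale ((-1) ^ (n + s)) (A (C n) (take s xs @ beta g (C 2) (take 2 (drop s xs)) # drop (s + 2) xs))) +
      (\<Sum>s<2. T.scale ((-1) ^ (2 + s * (n + 1)))
        (beta g (C 2) (take s xs @ A (C n) (take n (drop s xs)) # drop (s + n) xs)))
     else 0)"
    by (rule der_ext_circ_sum[where C = C and C' = C and \<theta> = A and \<beta> = "beta g" and p = n and q = n])
      (simp_all add: arity n A(2) M(3) Az beta_zero_entry)
  show "?l xs = ?r xs"
  proof (cases "length xs = N \<and> N = n + 1")
    case True
    then have len: "length xs = n + 1" by simp
    have "?l xs = transport e p e (\<lambda>as. \<Sum>s<n. sA ((-1) ^ (n + s)) (F (contract s as))) xs +
        transport e p e (\<lambda>as. F (butlast as) * last as + sA ((-1) ^ (n + 1)) (hd as * F (tl as))) xs"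
      unfolding * if_P[OF True] A(1)
      using inner_products[OF pair.summand_pair_axioms F len M(1,2)]
        outer_products[OF summand_axioms len M(1,2) beta_zero_entry, of F] by simp
    also have "\<dots> = transport e p e (\<lambda>as. sA ((-1) ^ (n + 1)) (b_self sA n F as)) xs"
      unfolding pair.transport_add
    proof (rule transport_cong)
      show "(\<Sum>s<n. sA ((-1) ^ (n + s)) (F (contract s (map p xs)))) +
          (F (butlast (map p xs)) * last (map p xs) + sA ((-1) ^ (n + 1)) (hd (map p xs) * F (tl (map p xs)))) =
        sA ((-1) ^ (n + 1)) (b_self sA n F (map p xs))"
        using len e.vs1.scale_sign_sign[of "n + 1"]
        by (simp add: b_self_def e.vs1.hochschild_contract e.vs1.sum_sign_shift
            e.vs1.scale_right_diff_distrib e.vs1.scale_right_distrib del: map_map)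
    qed
    finally show ?thesis using True by simp
  next
    case False
    then have "?r xs = 0"
      by (auto simp: transport_def b_self_def hochschild_def e.zero)
    then show ?thesis unfolding * if_not_P[OF False] by simp
  qed
qed

text \<open>The only term with the derivation at the upper vertex inserts \<open>Mu n\<close> into
  \<open>Fg 1\<close>, with sign \<open>(-1) ^ 1\<close>. This is the origin of
  \<open>- g (F us)\<close>, which the minus sign in front of the whole sum later reverses.\<close>

lemma der_ext_inner_Fg:
  assumes F: "F \<in> hom_pow sU sU n" and H: "H \<in> hom_pow sU sV (n - 1)" and n: "2 \<le> n"
    and A: "A (Mu n) = transport inB fst inB F" "\<And>i. i \<noteq> n \<Longrightarrow> A (Mu i) = 0"
      "A (Fg (n - 1)) = transport inB fst inW H" "\<And>i. i \<noteq> n - 1 \<Longrightarrow> A (Fg i) = 0"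
  shows "der_ext sU sV (beta g) A (\<Sum>(i, j)\<in>{(i, j). i + j = N + 1 \<and> i \<ge> 1 \<and> j \<ge> 2}. \<Sum>s=0..N - j.
      Poly_Mapping.single (circ (Fg i) s (Mu j)) ((-1) ^ (i + s * (j + 1)))) xs =
    (if length xs = N \<and> N = n then transport inB fst inW
      (\<lambda>us. (\<Sum>s<n - 1. sV ((-1) ^ (n - 1 + s)) (H (contract s us))) - g (F us)) xs else 0)"
    (is "?l = _")
proof -
  have Az: "A (Fg i) ys = 0" if "0 \<in> set ys" for i ys
    using A(3,4) tensor_hom_zero_entry[OF BW.transport_tensor_hom[OF H] that]
    by (cases "i = n - 1") simp_all
  have *: "?l = (if length xs = N \<and> N = n - 1 + 1 then
      (\<Sum>s<n - 1. T.scale ((-1) ^ (n - 1 + s))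
        (A (Fg (n - 1)) (take s xs @ beta g (Mu 2) (take 2 (drop s xs)) # drop (s + 2) xs))) +
      (\<Sum>s<1. T.scale ((-1) ^ (1 + s * (n + 1)))
        (beta g (Fg 1) (take s xs @ A (Mu n) (take n (drop s xs)) # drop (s + n) xs)))
     else 0)"
    using n by (intro der_ext_circ_sum) (simp_all add: A(2,4) beta_eq_0 Az beta_zero_entry)
  show ?thesis
  proof (cases "length xs = N \<and> N = n")
    case True
    then have len: "length xs = n - 1 + 1" "length xs = n" using n by simp_all
    have cond: "length xs = N \<and> N = n - 1 + 1" using True n by simp
    have inner: "(\<Sum>s<n - 1. T.scale ((-1) ^ (n - 1 + s))
        (transport inB fst inW H (take s xs @ beta g (Mu 2) (take 2 (drop s xs)) # drop (s + 2) xs))) =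
      transport inB fst inW (\<lambda>us. \<Sum>s<n - 1. sV ((-1) ^ (n - 1 + s)) (H (contract s us))) xs"
      by (rule inner_products[OF BW.summand_pair_axioms H len(1) beta_simps(1)])
        (simp add: beta_outside T_part_range)
    have "beta g (Fg 1) [transport inB fst inB F xs] = transport inB fst inW (\<lambda>us. g (F us)) xs"
      by (simp add: transport_def beta_simps[unfolded One_nat_def] beta_zero_entry)
    then have "?l = transport inB fst inW (\<lambda>us. \<Sum>s<n - 1. sV ((-1) ^ (n - 1 + s)) (H (contract s us))) xs +
        transport inB fst inW (\<lambda>us. - g (F us)) xs"
      unfolding * if_P[OF cond] A(1,3) inner BW.transport_uminus[symmetric]
      using len by simp
    then show ?thesis using True by (simp add: BW.transport_add)
  next
    case False
    then show ?thesis using n unfolding * by (simp only: if_False le_add_diff_inverse2)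
  qed
qed

lemma der_ext_outer_Fg:
  assumes G: "G \<in> hom_pow sV sV n" and n: "2 \<le> n"
    and A: "A (Nu n) = transport inW snd inW G" "\<And>i. i \<noteq> n \<Longrightarrow> A (Nu i) = 0"
      "A (Fg (n - 1)) = transport inB fst inW H" "\<And>i. i \<noteq> n - 1 \<Longrightarrow> A (Fg i) = 0"
  shows "der_ext sU sV (beta g) A (\<Sum>l=2..N. \<Sum>rs\<in>compositions l N.
      Poly_Mapping.single (Node (Nu l) (map (\<lambda>r. corolla (Fg r)) rs))
        ((-1) ^ (\<Sum>j<l. \<Sum>i<j. rs ! i * (rs ! j + 1)))) xs =
    (if length xs = N \<and> N = n then transport inB fst inW
      (\<lambda>us. G (map g us) + (sV ((-1) ^ n) (g (hd us) * H (tl us)) + H (butlast us) * g (last us))) xs else 0)"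
    (is "?l = _")
proof -
  have Az: "A (Nu i) ys = 0" if "0 \<in> set ys" for i ys
    using A(1,2) tensor_hom_zero_entry[OF WW.transport_tensor_hom[OF G] that]
    by (cases "i = n") simp_all
  have *: "?l = (if length xs = N \<and> N = n then
      A (Nu n) (map (\<lambda>x. beta g (Fg 1) [x]) xs) +
      T.scale ((-1) ^ n) (beta g (Nu 2) [beta g (Fg 1) (take 1 xs), A (Fg (n - 1)) (drop 1 xs)]) +
      beta g (Nu 2) [A (Fg (n - 1)) (take (n - 1) xs), beta g (Fg 1) (drop (n - 1) xs)]
     else 0)"
    using n by (intro der_ext_composition_sum) (auto simp add: A(2,4) beta_eq_0 Az beta_zero_entry)
  show ?thesis
  proof (cases "length xs = N \<and> N = n")
    case True
    then have len: "length xs = n" by simp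
    show ?thesis
    proof (cases "set xs \<subseteq> range inB")
      case sub: True
      obtain us where us: "xs = map inB us"
        using B.map_e_map_p[OF sub] by (rule that[OF sym])
      have len': "length us = n" using len us by simp
      have last: "take (n - 1) us = butlast us" "drop (n - 1) us = [last us]"
        using len' n by (cases us rule: rev_cases; simp)+
      have first: "take 1 us = [hd us]" "drop 1 us = tl us"
        using len' n by (cases us; simp)+
      have sub': "set (map inB vs) \<subseteq> range inB" "set (map inW ws) \<subseteq> range inW" for vs ws by auto
      have m: "map (\<lambda>x. beta g (Fg 1) [x]) (map inB us) = map inW (map g us)"
        by (simp only: map_map comp_def beta_simps)
      have "A (Nu n) (map (\<lambda>x. beta g (Fg 1) [x]) xs) = inW (G (map g us))"
        unfolding us m A(1) transport_def if_P[OF sub'(2)] W.map_p_map_e ..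
      moreover have "beta g (Nu 2) [beta g (Fg 1) (take 1 xs), A (Fg (n - 1)) (drop 1 xs)] =
          inW (g (hd us) * H (tl us))"
        unfolding us A(3) transport_def take_map drop_map first if_P[OF sub'(1)] B.map_p_map_e list.map
          beta_simps ..
      moreover have "beta g (Nu 2) [A (Fg (n - 1)) (take (n - 1) xs), beta g (Fg 1) (drop (n - 1) xs)] =
          inW (H (butlast us) * g (last us))"
        unfolding us A(3) transport_def take_map drop_map last if_P[OF sub'(1)] B.map_p_map_e list.map
          beta_simps ..
      ultimately have "?l = inW (G (map g us)) + T.scale ((-1) ^ n) (inW (g (hd us) * H (tl us))) +
          inW (H (butlast us) * g (last us))"
        unfolding * if_P[OF True] by simp
      also have "\<dots> = transport inB fst inW (\<lambda>us. G (map g us) +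
          (sV ((-1) ^ n) (g (hd us) * H (tl us)) + H (butlast us) * g (last us))) xs"
        unfolding us transport_def if_P[OF sub'(1)] B.map_p_map_e
        by (simp only: W.e.add W.e.scale add.assoc)
      finally show ?thesis using True by simp
    next
      case False
      then obtain x where x: "x \<in> set xs" "x \<notin> range inB" by blast
      have outside: "\<not> set ys \<subseteq> range inB \<Longrightarrow> beta g (Fg 1) ys = 0" for ys
        by (simp add: beta_outside T_part_range)
      have H0: "\<not> set ys \<subseteq> range inB \<Longrightarrow> transport inB fst inW H ys = (0 :: 'u \<times> 'v)"
        for ys :: "('u \<times> 'v) list"
        by (simp add: transport_def)
      have "beta g (Fg 1) [x] = 0" using x(2) by (intro outside) simp
      then have "0 \<in> set (map (\<lambda>x. beta g (Fg 1) [x]) xs)" using x(1)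
        by (auto simp: image_iff intro!: bexI[of _ x])
      then have "A (Nu n) (map (\<lambda>x. beta g (Fg 1) [x]) xs) = 0" by (rule Az)
      moreover have "beta g (Nu 2) [beta g (Fg 1) (take k xs), transport inB fst inW H (drop k xs)] = 0"
        "beta g (Nu 2) [transport inB fst inW H (take k xs), beta g (Fg 1) (drop k xs)] = 0" for k
      proof -
        \<comment> \<open>Whichever part of the list holds the entry outside the black summand, the
          operation applied to that part returns 0, so \<open>Nu 2\<close> receives a zero argument
          in both arrangements.\<close>
        have "set xs = set (take k xs) \<union> set (drop k xs)"
          by (metis append_take_drop_id set_append)
        then have "\<not> set (take k xs) \<subseteq> range inB \<or> \<not> set (drop k xs) \<subseteq> range inB"
          using False by blast
        then have "0 \<in> set [beta g (Fg 1) (take k xs), transport inB fst inW H (drop k xs)] \<and>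
            0 \<in> set [transport inB fst inW H (take k xs), beta g (Fg 1) (drop k xs)]"
          using outside[of "take k xs"] outside[of "drop k xs"] H0[of "take k xs"] H0[of "drop k xs"]
          by (elim disjE) simp_all
        then show "beta g (Nu 2) [beta g (Fg 1) (take k xs), transport inB fst inW H (drop k xs)] = 0"
          "beta g (Nu 2) [transport inB fst inW H (take k xs), beta g (Fg 1) (drop k xs)] = 0"
          using beta_zero_entry by blast+
      qed
      ultimately have "?l = 0"
        unfolding * if_P[OF True] A(3) by (simp only: T.p.scale_zero_right add_0)
      then show ?thesis using False by (simp add: transport_def)
    qed
  next
    case False
    then show ?thesis unfolding * by (simp only: if_False)
  qed
qed

text \<open>Both sums enter the boundary with a minus sign. The terms in \<open>H\<close> then have
  signs \<open>- (-1) ^ n\<close> on the left multiplication, \<open>(-1) ^ (n + s)\<close> inside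
  and \<open>-1\<close> on the right one, which is \<open>- (-1) ^ n\<close> times the Hochschild
  differential of a cochain with \<open>n - 1\<close> arguments.\<close>

lemma der_ext_Fg:
  assumes F: "F \<in> hom_pow sU sU n" and G: "G \<in> hom_pow sV sV n" and H: "H \<in> hom_pow sU sV (n - 1)"
    and n: "2 \<le> n"
    and A: "A (Mu n) = transport inB fst inB F" "\<And>i. i \<noteq> n \<Longrightarrow> A (Mu i) = 0"
      "A (Nu n) = transport inW snd inW G" "\<And>i. i \<noteq> n \<Longrightarrow> A (Nu i) = 0"
      "A (Fg (n - 1)) = transport inB fst inW H" "\<And>i. i \<noteq> n - 1 \<Longrightarrow> A (Fg i) = 0"
  shows "der_ext sU sV (beta g) A (bdry (Fg N)) = (if N = n then transport inB fst inW
    (\<lambda>us. g (F us) - G (map g us) - sV ((-1) ^ n) (b_via sV g (n - 1) H us)) else 0)"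
    (is "?l = ?r")
proof
  fix xs
  have *: "?l xs = - (if length xs = N \<and> N = n then transport inB fst inW
      (\<lambda>us. G (map g us) + (sV ((-1) ^ n) (g (hd us) * H (tl us)) + H (butlast us) * g (last us))) xs else 0)
    - (if length xs = N \<and> N = n then transport inB fst inW
      (\<lambda>us. (\<Sum>s<n - 1. sV ((-1) ^ (n - 1 + s)) (H (contract s us))) - g (F us)) xs else 0)"
    using der_ext_outer_Fg[where N = N and xs = xs, OF G n A(3-6)]
      der_ext_inner_Fg[where N = N and xs = xs, OF F H n A(1,2,5,6)]
    unfolding bdry.simps der_ext_lin_ext endo.lin_ext_diff endo.lin_ext_uminus minus_apply uminus_apply
    by simp
  show "?l xs = ?r xs"
  proof (cases "length xs = N \<and> N = n")
    case True
    then have len: "length (map fst xs) = n - 1 + 1" using n by simp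
    obtain k where k: "n = Suc k" using n by (cases n) auto
    have "?l xs = transport inB fst inW (\<lambda>us. - (G (map g us) + (sV ((-1) ^ n) (g (hd us) * H (tl us)) + H (butlast us) * g (last us))) +
        - ((\<Sum>s<n - 1. sV ((-1) ^ (n - 1 + s)) (H (contract s us))) - g (F us))) xs"
      unfolding * if_P[OF True] diff_conv_add_uminus BW.transport_uminus BW.transport_add ..
    also have "\<dots> = transport inB fst inW
        (\<lambda>us. g (F us) - G (map g us) - sV ((-1) ^ n) (b_via sV g (n - 1) H us)) xs"
    proof (rule transport_cong)
      show "- (G (map g (map fst xs)) + (sV ((-1) ^ n) (g (hd (map fst xs)) * H (tl (map fst xs))) +
            H (butlast (map fst xs)) * g (last (map fst xs)))) +
          - ((\<Sum>s<n - 1. sV ((-1) ^ (n - 1 + s)) (H (contract s (map fst xs)))) - g (F (map fst xs))) =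
        g (F (map fst xs)) - G (map g (map fst xs)) - sV ((-1) ^ n) (b_via sV g (n - 1) H (map fst xs))"
        unfolding b_via_def target.hochschild_contract[OF len] target.sum_sign_shift
        by (simp add: k target.scale_right_diff_distrib target.scale_right_distrib algebra_simps)
    qed
    finally show ?thesis using True by simp
  next
    case False
    have "?r xs = 0"
    proof (cases "N = n")
      case True
      with False have len: "length xs \<noteq> n" by simp
      have "F (map fst xs) = 0" "G (map g (map fst xs)) = 0"
        using F G len unfolding hom_pow_iff by (auto simp del: map_map)
      moreover have "b_via sV g (n - 1) H (map fst xs) = 0"
        using len n by (simp add: b_via_def hochschild_def)
      ultimately show ?thesis by (simp add: transport_def zero W.e.zero del: map_map)
    qed simp
    then show ?thesis unfolding * if_not_P[OF False] by simp
  qed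
qed

end

section \<open>The Gerstenhaber-Schack complex\<close>

text \<open>The asserted formula as an operator on triples, independent of the inverse of
  \<open>gs_tuple\<close> through which \<open>delta_GS\<close> is defined.\<close>

definition gs_delta ::
  "('k::field \<Rightarrow> 'u::ring \<Rightarrow> 'u) \<Rightarrow> ('k \<Rightarrow> 'v::ring \<Rightarrow> 'v) \<Rightarrow> ('u \<Rightarrow> 'v) \<Rightarrow> nat \<Rightarrow> ('u, 'v) gs \<Rightarrow> ('u, 'v) gs" where
  "gs_delta sU sV g n = (\<lambda>(F, G, H).
     (fun_scale sU ((-1) ^ (n + 1)) (b_self sU n F),
      fun_scale sV ((-1) ^ (n + 1)) (b_self sV n G),
      \<lambda>us. g (F us) - G (map g us) - sV ((-1) ^ n) (b_via sV g (n - 1) H us)))"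

definition gs_sign ::
  "('k::field \<Rightarrow> 'u::ab_group_add \<Rightarrow> 'u) \<Rightarrow> ('k \<Rightarrow> 'v::ab_group_add \<Rightarrow> 'v) \<Rightarrow> nat \<Rightarrow> ('u, 'v) gs \<Rightarrow> ('u, 'v) gs" where
  "gs_sign sU sV n = (\<lambda>(F, G, H).
     (fun_scale sU ((-1) ^ (n * (n + 1) div 2)) F,
      fun_scale sV ((-1) ^ (n * (n + 1) div 2)) G,
      fun_scale sV ((-1) ^ ((n - 1) * n div 2)) H))"

lemma gs_iso_eq: "gs_iso sU sV n \<theta> = gs_sign sU sV n (gs_tuple n \<theta>)"
  by (simp add: gs_iso_def gs_sign_def)

lemma (in vector_space) scale_sign_add:
  "scale ((-1) ^ (a + k)) (scale ((-1) ^ k) x) = scale ((-1) ^ a) x"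
  by (simp add: power_add mult.assoc flip: power_mult_distrib)

context algebra_morphism
begin

lemma subspace_hom_pow:
  "module.subspace (fun_scale sU) (hom_pow sU sU n)"
  "module.subspace (fun_scale sV) (hom_pow sV sV n)"
  "module.subspace (fun_scale sV) (hom_pow sU sV n)"
  using source.vector_space_axioms target.vector_space_axioms
    source.subspace_UNIV target.subspace_UNIV by (auto intro: subspace_tensor_hom)

sublocale fun_U: vector_space "fun_scale sU :: 'k \<Rightarrow> ('x \<Rightarrow> 'u) \<Rightarrow> 'x \<Rightarrow> 'u"
  by (rule vector_space_fun_scale) unfold_locales

sublocale fun_V: vector_space "fun_scale sV :: 'k \<Rightarrow> ('x \<Rightarrow> 'v) \<Rightarrow> 'x \<Rightarrow> 'v"
  by (rule vector_space_fun_scale) unfold_locales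

sublocale gs: vector_space "gs_scale sU sV"
  by unfold_locales (auto simp: gs_scale_def fun_U.scale_right_distrib fun_U.scale_left_distrib
      fun_V.scale_right_distrib fun_V.scale_left_distrib)

lemma subspace_C_GS: "gs.subspace (C_GS sU sV n)"
  using subspace_hom_pow(1)[of n] subspace_hom_pow(2)[of n] subspace_hom_pow(3)[of "n - 1"]
  unfolding gs.subspace_def fun_U.subspace_def fun_V.subspace_def C_GS_def
  by (auto simp: gs_scale_def zero_prod_def)

lemma g_comp_hom_pow: "F \<in> hom_pow sU sU n \<Longrightarrow> (\<lambda>us. g (F us)) \<in> hom_pow sU sV n"
  unfolding hom_pow_iff by (auto simp: add scale zero)

lemma hom_pow_comp_g: "G \<in> hom_pow sV sV n \<Longrightarrow> (\<lambda>us. G (map g us)) \<in> hom_pow sU sV n"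
  unfolding hom_pow_iff by (auto simp: map_update add scale)

text \<open>Naturality in the coefficients: \<open>g\<close> is a map of bimodules over the source
  algebra.\<close>

lemma b_via_g_comp: "b_via sV g n (\<lambda>us. g (F us)) us = g (b_self sU n F us)"
proof (cases "length us = n + 1")
  case True
  show ?thesis
    unfolding b_via_def b_self_def target.hochschild_contract[OF True] source.hochschild_contract[OF True]
    by (simp add: add diff neg scale sum map_mult)
qed (simp add: b_via_def b_self_def hochschild_def zero)

text \<open>Naturality in the algebra: \<open>g\<close> is multiplicative, so every face commutes
  with applying \<open>g\<close> to all entries.\<close>

lemma b_via_comp_g: "b_via sV g n (\<lambda>us. G (map g us)) us = b_self sV n G (map g us)"
proof (cases "length us = n + 1")
  case True
  then have "length (map g us) = n + 1" "us \<noteq> []" by auto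
  then show ?thesis
    unfolding b_via_def b_self_def target.hochschild_contract[OF True]
      target.hochschild_contract[OF \<open>length (map g us) = n + 1\<close>]
    by (simp add: map_contract map_mult hd_map last_map map_tl map_butlast)
qed (simp add: b_via_def b_self_def hochschild_def)

lemma hochschild_C_GS:
  assumes "n \<ge> 1" "(F, G, H) \<in> C_GS sU sV n"
  shows "b_self sU n F \<in> hom_pow sU sU (Suc n)" "b_self sV n G \<in> hom_pow sV sV (Suc n)"
    "b_via sV g (n - 1) H \<in> hom_pow sU sV n"
    "(\<lambda>us. g (F us) - G (map g us)) \<in> hom_pow sU sV n"
proof -
  have F: "F \<in> hom_pow sU sU n" and G: "G \<in> hom_pow sV sV n" and H: "H \<in> hom_pow sU sV (n - 1)"
    using assms(2) by (auto simp: C_GS_def)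
  show "b_self sU n F \<in> hom_pow sU sU (Suc n)" "b_self sV n G \<in> hom_pow sV sV (Suc n)"
    unfolding b_self_def using self_U.b_hom_pow[OF F] self_V.b_hom_pow[OF G] by auto
  show "b_via sV g (n - 1) H \<in> hom_pow sU sV n"
    unfolding b_via_def using via.b_hom_pow[OF H] assms(1) by simp
  have "(\<lambda>us. g (F us)) - (\<lambda>us. G (map g us)) \<in> hom_pow sU sV n"
    by (intro fun_V.subspace_diff subspace_hom_pow g_comp_hom_pow[OF F] hom_pow_comp_g[OF G])
  then show "(\<lambda>us. g (F us) - G (map g us)) \<in> hom_pow sU sV n"
    by (simp add: fun_diff_def)
qed

lemma gs_delta_C_GS:
  assumes "n \<ge> 1" "x \<in> C_GS sU sV n"
  shows "gs_delta sU sV g n x \<in> C_GS sU sV (Suc n)"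
proof -
  obtain F G H where x: "x = (F, G, H)" by (cases x)
  note h = hochschild_C_GS[OF assms[unfolded x]]
  have "(\<lambda>us. g (F us) - G (map g us)) - fun_scale sV ((-1) ^ n) (b_via sV g (n - 1) H) \<in> hom_pow sU sV n"
    by (intro fun_V.subspace_diff fun_V.subspace_scale subspace_hom_pow h)
  moreover have "fun_scale sU ((-1) ^ (n + 1)) (b_self sU n F) \<in> hom_pow sU sU (Suc n)"
    "fun_scale sV ((-1) ^ (n + 1)) (b_self sV n G) \<in> hom_pow sV sV (Suc n)"
    by (intro fun_U.subspace_scale fun_V.subspace_scale subspace_hom_pow h)+
  ultimately show ?thesis
    unfolding x gs_delta_def C_GS_def prod.case mem_Times_iff fst_conv snd_conv diff_Suc_1
    by (simp only: fun_diff_def fun_scale_apply simp_thms)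
qed

lemma d_GS_C_GS:
  assumes "n \<ge> 1" "x \<in> C_GS sU sV n"
  shows "d_GS sU sV g n x \<in> C_GS sU sV (Suc n)"
proof -
  obtain F G H where x: "x = (F, G, H)" by (cases x)
  note h = hochschild_C_GS[OF assms[unfolded x]]
  have "(\<lambda>us. g (F us) - G (map g us)) - b_via sV g (n - 1) H \<in> hom_pow sU sV n"
    by (intro fun_V.subspace_diff subspace_hom_pow h)
  then show ?thesis
    using h by (simp add: x d_GS_def C_GS_def fun_diff_def)
qed

lemma b_self_U_lin: "b_self sU n (\<lambda>us. sU c (F us) + sU d (F' us)) us = sU c (b_self sU n F us) + sU d (b_self sU n F' us)"
  unfolding b_self_def by (rule self_U.b_linear_combination)

lemma b_self_V_lin: "b_self sV n (\<lambda>us. sV c (F us) + sV d (F' us)) us = sV c (b_self sV n F us) + sV d (b_self sV n F' us)"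
  unfolding b_self_def by (rule self_V.b_linear_combination)

lemma b_via_lin: "b_via sV g n (\<lambda>us. sV c (F us) + sV d (F' us)) us = sV c (b_via sV g n F us) + sV d (b_via sV g n F' us)"
  unfolding b_via_def by (rule via.b_linear_combination)

lemma b_add:
  "b_self sU n (F + F') = b_self sU n F + b_self sU n F'"
  "b_self sV n (G + G') = b_self sV n G + b_self sV n G'"
  "b_via sV g n (H + H') = b_via sV g n H + b_via sV g n H'"
  using b_self_U_lin[of n 1 F 1 F'] b_self_V_lin[of n 1 G 1 G'] b_via_lin[of n 1 H 1 H']
  by (auto simp: plus_fun_def)

lemma b_scale:
  "b_self sU n (fun_scale sU c F) = fun_scale sU c (b_self sU n F)"
  "b_self sV n (fun_scale sV c G) = fun_scale sV c (b_self sV n G)"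
  "b_via sV g n (fun_scale sV c H) = fun_scale sV c (b_via sV g n H)"
  using b_self_U_lin[of n c F 0 F] b_self_V_lin[of n c G 0 G] b_via_lin[of n c H 0 H]
  by (auto simp: fun_scale_def)

lemma b_diff_via: "b_via sV g n (H - H') = b_via sV g n H - b_via sV g n H'"
  using b_add(3)[of n "H - H'" H'] by (simp add: algebra_simps)

lemma linear_d_GS: "linear_on_set (gs_scale sU sV) (gs_scale sU sV) C (d_GS sU sV g n)"
  unfolding linear_on_set_def
  by (auto simp: d_GS_def gs_scale_def b_add b_scale add scale fun_scale_apply fun_eq_iff
      target.scale_right_diff_distrib algebra_simps)

text \<open>In the last component the two naturality statements and \<open>b_squared\<close> reduce
  \<open>b\<close> of the mixed cochain to \<open>g\<close> after \<open>b F\<close> minus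
  \<open>b G\<close> after \<open>g\<close>, which cancels the two new mixed terms.\<close>

lemma d_GS_d_GS:
  assumes "n \<ge> 1"
  shows "d_GS sU sV g (Suc n) (d_GS sU sV g n x) = 0"
proof -
  obtain F G H where x: "x = (F, G, H)" by (cases x)
  obtain m where m: "n = Suc m" using assms by (cases n) auto
  have "(\<lambda>us. g (F us) - G (map g us) - b_via sV g (n - 1) H us) =
      (\<lambda>us. g (F us)) - (\<lambda>us. G (map g us)) - b_via sV g (n - 1) H"
    by (simp add: fun_eq_iff)
  then have "b_via sV g n (\<lambda>us. g (F us) - G (map g us) - b_via sV g (n - 1) H us) us =
      g (b_self sU n F us) - b_self sV n G (map g us)" for us
    using via.b_squared[of m H us]
    by (simp add: b_diff_via b_via_g_comp b_via_comp_g m) (simp add: b_via_def)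
  then show ?thesis
    using self_U.b_squared[of n F] self_V.b_squared[of n G]
    by (simp add: x d_GS_def zero_prod_def fun_eq_iff b_self_def)
qed

lemma gs_sign_involution: "gs_sign sU sV n (gs_sign sU sV n x) = x"
  by (cases x) (simp add: gs_sign_def)

lemma gs_sign_C_GS: "x \<in> C_GS sU sV n \<Longrightarrow> gs_sign sU sV n x \<in> C_GS sU sV n"
  by (auto simp: gs_sign_def C_GS_def intro: fun_U.subspace_scale[OF subspace_hom_pow(1)]
      fun_V.subspace_scale[OF subspace_hom_pow(2)] fun_V.subspace_scale[OF subspace_hom_pow(3)])

lemma bij_gs_sign: "bij_betw (gs_sign sU sV n) (C_GS sU sV n) (C_GS sU sV n)"
  by (rule bij_betw_byWitness[of _ "gs_sign sU sV n"]) (auto simp: gs_sign_involution gs_sign_C_GS)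

text \<open>The last component in degree \<open>n + 1\<close> is twisted by the same triangular
  number as the first two in degree \<open>n\<close>, so the mixed terms match without further
  signs; the terms in \<open>b\<close> are matched by the differences of consecutive triangular
  numbers.\<close>

lemma gs_sign_gs_delta:
  assumes "n \<ge> 1"
  shows "gs_sign sU sV (Suc n) (gs_delta sU sV g n x) = d_GS sU sV g n (gs_sign sU sV n x)"
proof -
  obtain F G H where x: "x = (F, G, H)" by (cases x)
  obtain m where m: "n = Suc m" using assms by (cases n) auto
  have e: "Suc n * (Suc n + 1) div 2 = n * (n + 1) div 2 + (n + 1)"
    by (simp add: algebra_simps)
  have e': "n * (n + 1) div 2 = (n - 1) * n div 2 + n"
    by (simp add: m algebra_simps)
  have e'': "(Suc n - 1) * Suc n div 2 = n * (n + 1) div 2"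
    by simp
  have k: "sV ((-1) ^ (n * (n + 1) div 2)) (sV ((-1) ^ n) y) = sV ((-1) ^ ((n - 1) * n div 2)) y" for y
    unfolding e' by (rule target.scale_sign_add)
  show ?thesis
    unfolding x gs_sign_def gs_delta_def d_GS_def prod.case e e'' fun_U.scale_sign_add fun_V.scale_sign_add b_scale
    by (simp only: fun_scale_def target.scale_right_diff_distrib scale k)
qed

section \<open>Comparison of the two complexes\<close>

text \<open>From \<open>n = 2\<close> on, \<open>Mu n\<close>, \<open>Nu n\<close> and
  \<open>Fg (n - 1)\<close> are generators, so the three values lie in the expected components and
  are recovered from the triple by extension by zero.\<close>

lemma gs_tuple_C_GS:
  assumes \<theta>: "\<theta> \<in> C_As sU sV (n - 1)" and n: "n \<ge> 2" and tuple: "gs_tuple n \<theta> = (F, G, H)"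
  shows "(F, G, H) \<in> C_GS sU sV n"
    and "\<theta> (gen_vec (Mu n)) = transport inB fst inB F" "\<theta> (gen_vec (Nu n)) = transport inW snd inW G"
    and "\<theta> (gen_vec (Fg (n - 1))) = transport inB fst inW H"
proof -
  have "\<theta> (gen_vec (Mu n)) \<in> gen_space sU sV (Mu n)" "\<theta> (gen_vec (Nu n)) \<in> gen_space sU sV (Nu n)"
    "\<theta> (gen_vec (Fg (n - 1))) \<in> gen_space sU sV (Fg (n - 1))"
    using n by (intro C_As_gen_space[OF \<theta>]; simp)+
  note mem = this[unfolded gen_space_def arity.simps in_color.simps out_color.simps T_part_range]
  have "F = (\<lambda>us. fst (\<theta> (gen_vec (Mu n)) (map inB us)))" "G = (\<lambda>vs. snd (\<theta> (gen_vec (Nu n)) (map inW vs)))"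
    "H = (\<lambda>us. snd (\<theta> (gen_vec (Fg (n - 1))) (map inB us)))"
    using tuple by (simp_all add: gs_tuple_def)
  then show "(F, G, H) \<in> C_GS sU sV n" "\<theta> (gen_vec (Mu n)) = transport inB fst inB F"
    "\<theta> (gen_vec (Nu n)) = transport inW snd inW G" "\<theta> (gen_vec (Fg (n - 1))) = transport inB fst inW H"
    using BB.transport_inverse[OF mem(1)] WW.transport_inverse[OF mem(2)] BW.transport_inverse[OF mem(3)]
    by (simp_all add: C_GS_def)
qed

lemma C_As_zero_off:
  assumes \<theta>: "\<theta> \<in> C_As sU sV (n - 1)" and n: "n \<ge> 2"
  shows "i \<noteq> n \<Longrightarrow> \<theta> (gen_vec (Mu i)) = 0" "i \<noteq> n \<Longrightarrow> \<theta> (gen_vec (Nu i)) = 0"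
    "i \<noteq> n - 1 \<Longrightarrow> \<theta> (gen_vec (Fg i)) = 0"
  using n by (intro C_As_zero[OF \<theta>]; auto)+

lemma C_As_tuple_inj:
  assumes "n \<ge> 2" "\<theta> \<in> C_As sU sV (n - 1)" "\<theta>' \<in> C_As sU sV (n - 1)" "gs_tuple n \<theta> = gs_tuple n \<theta>'"
  shows "\<theta> = \<theta>'"
proof -
  obtain F G H where t: "gs_tuple n \<theta> = (F, G, H)" by (cases "gs_tuple n \<theta>")
  have "\<theta> (gen_vec \<xi>) = \<theta>' (gen_vec \<xi>)" for \<xi>
  proof (cases \<xi>)
    case (Mu i)
    then show ?thesis
      using gs_tuple_C_GS(2)[OF assms(2,1) t] gs_tuple_C_GS(2)[OF assms(3,1) t[unfolded assms(4)]]
        C_As_zero_off(1)[OF assms(2,1)] C_As_zero_off(1)[OF assms(3,1)] by (cases "i = n") simp_all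
  next
    case (Nu i)
    then show ?thesis
      using gs_tuple_C_GS(3)[OF assms(2,1) t] gs_tuple_C_GS(3)[OF assms(3,1) t[unfolded assms(4)]]
        C_As_zero_off(2)[OF assms(2,1)] C_As_zero_off(2)[OF assms(3,1)] by (cases "i = n") simp_all
  next
    case (Fg i)
    then show ?thesis
      using gs_tuple_C_GS(4)[OF assms(2,1) t] gs_tuple_C_GS(4)[OF assms(3,1) t[unfolded assms(4)]]
        C_As_zero_off(3)[OF assms(2,1)] C_As_zero_off(3)[OF assms(3,1)] by (cases "i = n - 1") simp_all
  qed
  then show ?thesis
    using C_As_eq_equivariant_ext[OF assms(2)] C_As_eq_equivariant_ext[OF assms(3)] by simp
qed


text \<open>Used twice: it gives surjectivity of \<open>gs_tuple\<close>, and it reads off the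
  triple of \<open>delta_As\<close>, which is itself an equivariant extension.\<close>

lemma equivariant_ext_tuple:
  assumes n: "n \<ge> 2" and x: "(F, G, H) \<in> C_GS sU sV n"
    and \<psi>: "\<And>i. \<psi> (Mu i) = (if i = n then transport inB fst inB F else 0)"
      "\<And>i. \<psi> (Nu i) = (if i = n then transport inW snd inW G else 0)"
      "\<And>i. \<psi> (Fg i) = (if i = n - 1 then transport inB fst inW H else 0)"
  shows "equivariant_ext sU sV \<psi> \<in> C_As sU sV (n - 1)"
    and "gs_tuple n (equivariant_ext sU sV \<psi>) = (F, G, H)"
proof -
  have mem: "F \<in> hom_pow sU sU n" "G \<in> hom_pow sV sV n" "H \<in> hom_pow sU sV (n - 1)"
    using x by (simp_all add: C_GS_def)
  have "0 \<in> gen_space sU sV \<xi>" for \<xi>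
    using endo.subspace_0[OF subspace_End_T] by (simp flip: End_T_gen)
  moreover have "transport inB fst inB F \<in> gen_space sU sV (Mu n)"
    "transport inW snd inW G \<in> gen_space sU sV (Nu n)"
    "transport inB fst inW H \<in> gen_space sU sV (Fg (n - 1))"
    using BB.transport_tensor_hom[OF mem(1)] WW.transport_tensor_hom[OF mem(2)]
      BW.transport_tensor_hom[OF mem(3)] by (simp_all add: gen_space_def T_part_range)
  ultimately show "equivariant_ext sU sV \<psi> \<in> C_As sU sV (n - 1)"
  proof (intro equivariant_ext_C_As)
    fix \<xi>
    show "\<psi> \<xi> \<in> gen_space sU sV \<xi>"
      using \<open>\<And>\<xi>. 0 \<in> gen_space sU sV \<xi>\<close> \<open>transport inB fst inB F \<in> _\<close> \<open>transport inW snd inW G \<in> _\<close>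
        \<open>transport inB fst inW H \<in> _\<close> by (cases \<xi>) (simp_all add: \<psi>)
    assume "gen_degree \<xi> \<noteq> int (n - 1) - 1"
    then show "\<psi> \<xi> = 0" using n by (cases \<xi>) (auto simp: \<psi>)
  qed
  show "gs_tuple n (equivariant_ext sU sV \<psi>) = (F, G, H)"
    using n by (simp add: gs_tuple_def equivariant_ext_gen_vec \<psi>)
qed

lemma bij_gs_tuple:
  assumes n: "n \<ge> 2"
  shows "bij_betw (gs_tuple n) (C_As sU sV (n - 1)) (C_GS sU sV n)"
proof (intro bij_betw_imageI inj_onI equalityI subsetI)
  fix \<theta> \<theta>' assume "\<theta> \<in> C_As sU sV (n - 1)" "\<theta>' \<in> C_As sU sV (n - 1)" "gs_tuple n \<theta> = gs_tuple n \<theta>'"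
  then show "\<theta> = \<theta>'" by (rule C_As_tuple_inj[OF n])
next
  fix x assume "x \<in> gs_tuple n ` C_As sU sV (n - 1)"
  then obtain \<theta> where \<theta>: "\<theta> \<in> C_As sU sV (n - 1)" "x = gs_tuple n \<theta>"
    by blast
  moreover obtain F G H where t: "gs_tuple n \<theta> = (F, G, H)" by (cases "gs_tuple n \<theta>")
  ultimately show "x \<in> C_GS sU sV n"
    using gs_tuple_C_GS(1)[OF \<theta>(1) n t] by simp
next
  fix x assume x: "x \<in> C_GS sU sV n"
  obtain F G H where FGH: "x = (F, G, H)" by (cases x)
  define \<psi> where "\<psi> \<xi> = (case \<xi> of
      Mu i \<Rightarrow> if i = n then transport inB fst inB F else 0
    | Nu i \<Rightarrow> if i = n then transport inW snd inW G else 0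
    | Fg i \<Rightarrow> if i = n - 1 then transport inB fst inW H else 0)" for \<xi>
  have "equivariant_ext sU sV \<psi> \<in> C_As sU sV (n - 1)" "gs_tuple n (equivariant_ext sU sV \<psi>) = (F, G, H)"
    using equivariant_ext_tuple[OF n x[unfolded FGH], of \<psi>] by (simp_all add: \<psi>_def)
  then show "x \<in> gs_tuple n ` C_As sU sV (n - 1)"
    unfolding FGH by (intro image_eqI[OF sym])
qed

text \<open>The values on generators are extensions by zero of the components of
  \<open>gs_delta\<close>, supported in arity \<open>n + 1\<close> for \<open>Mu\<close> and
  \<open>Nu\<close> and in arity \<open>n\<close> for \<open>Fg\<close>. This support is exactly
  that of a cochain one degree higher.\<close>

lemma delta_As_tuple:
  assumes n: "n \<ge> 2" and \<theta>: "\<theta> \<in> C_As sU sV (n - 1)"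
  shows "delta_As sU sV g \<theta> \<in> C_As sU sV n"
    and "gs_tuple (Suc n) (delta_As sU sV g \<theta>) = gs_delta sU sV g n (gs_tuple n \<theta>)"
proof -
  obtain F G H where t: "gs_tuple n \<theta> = (F, G, H)" by (cases "gs_tuple n \<theta>")
  note C = gs_tuple_C_GS[OF \<theta> n t] and off = C_As_zero_off[OF \<theta> n]
  have mem: "F \<in> hom_pow sU sU n" "G \<in> hom_pow sV sV n" "H \<in> hom_pow sU sV (n - 1)"
    using C(1) by (simp_all add: C_GS_def)
  obtain F' G' H' where d: "gs_delta sU sV g n (F, G, H) = (F', G', H')"
    by (cases "gs_delta sU sV g n (F, G, H)")
  then have F': "F' = (\<lambda>us. sU ((-1) ^ (n + 1)) (b_self sU n F us))"
    and G': "G' = (\<lambda>us. sV ((-1) ^ (n + 1)) (b_self sV n G us))"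
    and H': "H' = (\<lambda>us. g (F us) - G (map g us) - sV ((-1) ^ n) (b_via sV g (n - 1) H us))"
    unfolding gs_delta_def fun_scale_def by auto
  have d_mem: "(F', G', H') \<in> C_GS sU sV (Suc n)"
    using gs_delta_C_GS[OF _ C(1)] n by (simp add: d)
  define \<psi> where "\<psi> \<xi> = der_ext sU sV (beta g) (\<lambda>\<eta>. \<theta> (gen_vec \<eta>)) (bdry \<xi>)" for \<xi>
  have "\<psi> (Mu i) = (if i = Suc n then transport inB fst inB F' else 0)" for i
    unfolding \<psi>_def F' bdry.simps Suc_eq_plus1
    by (rule der_ext_self[OF B.summand_axioms mem(1) n])
      (simp_all add: C off beta_simps beta_eq_0 beta_outside T_part_range)
  moreover have "\<psi> (Nu i) = (if i = Suc n then transport inW snd inW G' else 0)" for i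
    unfolding \<psi>_def G' bdry.simps Suc_eq_plus1
    by (rule der_ext_self[OF W.summand_axioms mem(2) n])
      (simp_all add: C off beta_simps beta_eq_0 beta_outside T_part_range)
  moreover have "\<psi> (Fg i) = (if i = Suc n - 1 then transport inB fst inW H' else 0)" for i
    unfolding \<psi>_def H' diff_Suc_1
    by (rule der_ext_Fg[OF mem n]) (simp_all add: C off flip: One_nat_def)
  moreover have "delta_As sU sV g \<theta> = equivariant_ext sU sV \<psi>"
    by (simp add: delta_As_def \<psi>_def[abs_def])
  ultimately show "delta_As sU sV g \<theta> \<in> C_As sU sV n"
    "gs_tuple (Suc n) (delta_As sU sV g \<theta>) = gs_delta sU sV g n (gs_tuple n \<theta>)"
    using equivariant_ext_tuple[OF _ d_mem, of \<psi>] n by (simp_all add: t d)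
qed

lemma subspace_C_As: "As.subspace (C_As sU sV m)"
proof -
  have End: "0 \<in> End_T sU sV cs d" "x \<in> End_T sU sV cs d \<Longrightarrow> y \<in> End_T sU sV cs d \<Longrightarrow> x + y \<in> End_T sU sV cs d"
    "x \<in> End_T sU sV cs d \<Longrightarrow> endo_scale sU sV c x \<in> End_T sU sV cs d" for cs d x y c
    using subspace_End_T[of cs d] by (auto simp: endo.subspace_def)
  have lin: "Vector_Spaces.linear E_scale (endo_scale sU sV) \<theta> \<longleftrightarrow>
      (\<forall>x y. \<theta> (x + y) = \<theta> x + \<theta> y) \<and> (\<forall>c x. \<theta> (E_scale c x) = endo_scale sU sV c (\<theta> x))" for \<theta>
    using vector_space_E_scale endo.vector_space_axioms by (auto simp: Vector_Spaces.linear_iff)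
  show ?thesis
  proof (rule As.subspaceI)
    show "0 \<in> C_As sU sV m"
      unfolding C_As_def lin by (simp add: End)
  next
    fix \<theta> \<theta>' assume "\<theta> \<in> C_As sU sV m" "\<theta>' \<in> C_As sU sV m"
    then show "\<theta> + \<theta>' \<in> C_As sU sV m"
      unfolding C_As_def lin
      by (simp add: End endo.scale_right_distrib endo_act_add algebra_simps)
  next
    fix \<theta> c assume "\<theta> \<in> C_As sU sV m"
    then show "As_scale sU sV c \<theta> \<in> C_As sU sV m"
      unfolding C_As_def lin
      by (simp add: fun_scale_apply[of "endo_scale sU sV"] End endo.scale_right_distrib endo_act_scale
          endo.scale_left_commute)
  qed
qed

section \<open>The lowest degree and transport of the complex axioms\<close>

lemma C_As_0:
  assumes "\<theta> \<in> C_As sU sV 0"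
  shows "\<theta> = 0"
proof -
  have "\<theta> (gen_vec \<xi>) = 0" for \<xi>
    by (rule C_As_zero[OF assms]) (cases \<xi>; auto)
  then have "\<theta> = equivariant_ext sU sV (\<lambda>_. 0)"
    using C_As_eq_equivariant_ext[OF assms] by simp
  then show ?thesis
    by (simp add: equivariant_ext_def fun_eq_iff)
qed

lemma gs_tuple_add: "gs_tuple n (\<theta> + \<theta>') = gs_tuple n \<theta> + gs_tuple n \<theta>'"
  by (simp add: gs_tuple_def fun_eq_iff)

lemma gs_tuple_scale: "gs_tuple n (As_scale sU sV c \<theta>) = gs_scale sU sV c (gs_tuple n \<theta>)"
  by (simp add: gs_tuple_def gs_scale_def fun_scale_def T.scale_def)

lemma gs_iso_add: "gs_iso sU sV n (\<theta> + \<theta>') = gs_iso sU sV n \<theta> + gs_iso sU sV n \<theta>'"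
  by (cases "gs_tuple n \<theta>"; cases "gs_tuple n \<theta>'")
    (simp add: gs_iso_eq gs_tuple_add gs_sign_def fun_U.scale_right_distrib fun_V.scale_right_distrib)

lemma gs_iso_scale: "gs_iso sU sV n (As_scale sU sV c \<theta>) = gs_scale sU sV c (gs_iso sU sV n \<theta>)"
  by (cases "gs_tuple n \<theta>")
    (simp add: gs_iso_eq gs_tuple_scale gs_sign_def gs_scale_def fun_U.scale_left_commute fun_V.scale_left_commute)

lemma gs_iso_0: "gs_iso sU sV n 0 = 0"
  using gs_iso_add[of n 0 0] by simp

lemma bij_gs_iso:
  assumes "n \<ge> 2"
  shows "bij_betw (gs_iso sU sV n) (C_As sU sV (n - 1)) (C_GS sU sV n)"
proof -
  have "gs_iso sU sV n = gs_sign sU sV n \<circ> gs_tuple n"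
    by (simp add: fun_eq_iff gs_iso_eq)
  then show ?thesis
    using bij_betw_trans[OF bij_gs_tuple[OF assms] bij_gs_sign] by simp
qed

text \<open>The index \<open>Suc n\<close> is at least 2 already for \<open>n = 1\<close>, so
  identities between differentials can be tested after \<open>gs_iso\<close> even when the cochains
  themselves lie in \<open>C_As sU sV 0\<close>.\<close>

lemma gs_iso_inj:
  assumes "n \<ge> 1" "\<theta> \<in> C_As sU sV n" "\<theta>' \<in> C_As sU sV n" "gs_iso sU sV (Suc n) \<theta> = gs_iso sU sV (Suc n) \<theta>'"
  shows "\<theta> = \<theta>'"
  using bij_betw_imp_inj_on[OF bij_gs_iso, of "Suc n"] assms by (auto dest: inj_onD)

lemma d_GS_0: "d_GS sU sV g n 0 = 0"
  using linear_d_GS[of "{0}" n] by (simp add: linear_on_set_def)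

lemma C_As_0_mem: "0 \<in> C_As sU sV m"
  using subspace_C_As by (rule As.subspace_0)

text \<open>\<open>0\<close> is an element of every \<open>C_As m\<close>, so the formula in degree 2 determines \<open>\<delta> 0\<close>.\<close>

lemma delta_As_0: "delta_As sU sV g 0 = 0"
proof -
  have "gs_iso sU sV (Suc 2) (delta_As sU sV g 0) = gs_iso sU sV (Suc 2) 0"
    using delta_As_tuple(2)[OF order_refl C_As_0_mem]
    by (simp only: gs_iso_eq gs_sign_gs_delta one_le_numeral) (simp only: gs_iso_eq[symmetric] gs_iso_0 d_GS_0)
  then show ?thesis
    using delta_As_tuple(1)[OF order_refl C_As_0_mem] C_As_0_mem by (intro gs_iso_inj[of 2]) simp_all
qed

lemma delta_As_C_As:
  assumes "n \<ge> 1" "\<theta> \<in> C_As sU sV (n - 1)"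
  shows "delta_As sU sV g \<theta> \<in> C_As sU sV n"
    and "gs_iso sU sV (Suc n) (delta_As sU sV g \<theta>) = d_GS sU sV g n (gs_iso sU sV n \<theta>)"
proof -
  have "delta_As sU sV g \<theta> \<in> C_As sU sV n \<and>
    gs_iso sU sV (Suc n) (delta_As sU sV g \<theta>) = d_GS sU sV g n (gs_iso sU sV n \<theta>)"
  proof (cases "n = 1")
    case True
    then have "\<theta> = 0" using assms(2) C_As_0 by simp
    then show ?thesis by (simp add: delta_As_0 C_As_0_mem gs_iso_0 d_GS_0)
  next
    case False
    then have "n \<ge> 2" using assms(1) by simp
    from delta_As_tuple[OF this assms(2)] show ?thesis
      using assms(1) by (simp add: gs_iso_eq gs_sign_gs_delta)
  qed
  then show "delta_As sU sV g \<theta> \<in> C_As sU sV n"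
    "gs_iso sU sV (Suc n) (delta_As sU sV g \<theta>) = d_GS sU sV g n (gs_iso sU sV n \<theta>)" by auto
qed

text \<open>The signs are removed by the involution \<open>gs_sign\<close>. Passing through the
  signed identity includes \<open>n = 1\<close>.\<close>

lemma gs_tuple_delta_As:
  assumes "n \<ge> 1" "\<theta> \<in> C_As sU sV (n - 1)"
  shows "gs_tuple (Suc n) (delta_As sU sV g \<theta>) = gs_delta sU sV g n (gs_tuple n \<theta>)"
proof -
  have "gs_sign sU sV (Suc n) (gs_tuple (Suc n) (delta_As sU sV g \<theta>)) =
      gs_sign sU sV (Suc n) (gs_delta sU sV g n (gs_tuple n \<theta>))"
    using delta_As_C_As(2)[OF assms] assms(1) by (simp add: gs_iso_eq gs_sign_gs_delta)
  then show ?thesis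
    by (metis gs_sign_involution)
qed

lemma inj_on_gs_tuple:
  assumes "n \<ge> 1"
  shows "inj_on (gs_tuple n) (C_As sU sV (n - 1))"
proof (cases "n = 1")
  case True
  then show ?thesis by (auto intro!: inj_onI dest: C_As_0)
next
  case False
  then show ?thesis using assms by (intro bij_betw_imp_inj_on[OF bij_gs_tuple]) simp
qed

text \<open>The triple is given as the image of \<open>\<theta>\<close>, so injectivity of
  \<open>gs_tuple\<close> makes \<open>inv_into\<close> return \<open>\<theta>\<close>. This
  includes \<open>n = 1\<close>, where the image consists of 0.\<close>

lemma delta_GS_tuple:
  assumes "n \<ge> 1" "\<theta> \<in> C_As sU sV (n - 1)"
  shows "delta_GS sU sV g n (gs_tuple n \<theta>) = gs_delta sU sV g n (gs_tuple n \<theta>)"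
  using inv_into_f_f[OF inj_on_gs_tuple[OF assms(1)] assms(2)] gs_tuple_delta_As[OF assms]
  by (simp add: delta_GS_def)

lemma delta_As_add:
  assumes "n \<ge> 1" "\<theta> \<in> C_As sU sV (n - 1)" "\<theta>' \<in> C_As sU sV (n - 1)"
  shows "delta_As sU sV g (\<theta> + \<theta>') = delta_As sU sV g \<theta> + delta_As sU sV g \<theta>'"
proof (rule gs_iso_inj[OF assms(1)])
  note sum = As.subspace_add[OF subspace_C_As assms(2,3)]
  show "delta_As sU sV g (\<theta> + \<theta>') \<in> C_As sU sV n"
    by (rule delta_As_C_As(1)[OF assms(1) sum])
  show "delta_As sU sV g \<theta> + delta_As sU sV g \<theta>' \<in> C_As sU sV n"
    by (intro As.subspace_add[OF subspace_C_As] delta_As_C_As(1) assms)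
  show "gs_iso sU sV (Suc n) (delta_As sU sV g (\<theta> + \<theta>')) =
      gs_iso sU sV (Suc n) (delta_As sU sV g \<theta> + delta_As sU sV g \<theta>')"
    using linear_d_GS[of UNIV n]
    unfolding gs_iso_add delta_As_C_As(2)[OF assms(1) sum] delta_As_C_As(2)[OF assms(1,2)]
      delta_As_C_As(2)[OF assms(1,3)] linear_on_set_def by blast
qed

lemma delta_As_scale:
  assumes "n \<ge> 1" "\<theta> \<in> C_As sU sV (n - 1)"
  shows "delta_As sU sV g (As_scale sU sV c \<theta>) = As_scale sU sV c (delta_As sU sV g \<theta>)"
proof (rule gs_iso_inj[OF assms(1)])
  note mult = As.subspace_scale[OF subspace_C_As assms(2)]
  show "delta_As sU sV g (As_scale sU sV c \<theta>) \<in> C_As sU sV n"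
    by (rule delta_As_C_As(1)[OF assms(1) mult])
  show "As_scale sU sV c (delta_As sU sV g \<theta>) \<in> C_As sU sV n"
    by (intro As.subspace_scale[OF subspace_C_As] delta_As_C_As(1) assms)
  show "gs_iso sU sV (Suc n) (delta_As sU sV g (As_scale sU sV c \<theta>)) =
      gs_iso sU sV (Suc n) (As_scale sU sV c (delta_As sU sV g \<theta>))"
    using linear_d_GS[of UNIV n]
    unfolding gs_iso_scale delta_As_C_As(2)[OF assms(1) mult] delta_As_C_As(2)[OF assms]
      linear_on_set_def by blast
qed

lemma delta_As_delta_As:
  assumes "n \<ge> 1" "\<theta> \<in> C_As sU sV (n - 1)"
  shows "delta_As sU sV g (delta_As sU sV g \<theta>) = 0"
proof (rule gs_iso_inj[of "Suc n"])
  have mem: "delta_As sU sV g \<theta> \<in> C_As sU sV (Suc n - 1)"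
    using delta_As_C_As(1)[OF assms] by simp
  show "delta_As sU sV g (delta_As sU sV g \<theta>) \<in> C_As sU sV (Suc n)"
    by (rule delta_As_C_As(1)[OF _ mem]) simp
  show "gs_iso sU sV (Suc (Suc n)) (delta_As sU sV g (delta_As sU sV g \<theta>)) = gs_iso sU sV (Suc (Suc n)) 0"
    using delta_As_C_As(2)[OF _ mem] delta_As_C_As(2)[OF assms] d_GS_d_GS[OF assms(1)]
    by (simp add: gs_iso_0)
qed (simp_all add: C_As_0_mem)

lemma gs_iso_C_GS:
  assumes "n \<ge> 1" "\<theta> \<in> C_As sU sV (n - 1)"
  shows "gs_iso sU sV n \<theta> \<in> C_GS sU sV n"
proof (cases "n = 1")
  case True
  then have "\<theta> = 0" using assms(2) C_As_0 by simp
  then show ?thesis using gs.subspace_0[OF subspace_C_GS] by (simp add: gs_iso_0)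
next
  case False
  then show ?thesis using assms by (intro bij_betw_apply[OF bij_gs_iso]) simp_all
qed

lemma cochain_complex_As:
  "cochain_complex 1 (As_scale sU sV) (\<lambda>n. C_As sU sV (n - 1)) (\<lambda>n. delta_As sU sV g)"
  unfolding cochain_complex_def linear_on_set_def
  using As.vector_space_axioms subspace_C_As delta_As_add delta_As_scale delta_As_delta_As delta_As_C_As(1)
  by simp

lemma cochain_complex_GS: "cochain_complex 1 (gs_scale sU sV) (C_GS sU sV) (d_GS sU sV g)"
  unfolding cochain_complex_def
  using gs.vector_space_axioms subspace_C_GS linear_d_GS d_GS_C_GS d_GS_d_GS by simp

lemma cochain_map_gs_iso:
  "cochain_map 1 (As_scale sU sV) (\<lambda>n. C_As sU sV (n - 1)) (\<lambda>n. delta_As sU sV g)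
    (gs_scale sU sV) (C_GS sU sV) (d_GS sU sV g) (gs_iso sU sV)"
  unfolding cochain_map_def linear_on_set_def
  using gs_iso_add gs_iso_scale gs_iso_C_GS delta_As_C_As(2) by simp

end

theorem theorem5p5:
  fixes sU :: "'k::field_char_0 \<Rightarrow> 'u::ring \<Rightarrow> 'u"
    and sV :: "'k \<Rightarrow> 'v::ring \<Rightarrow> 'v"
    and g :: "'u \<Rightarrow> 'v"
  assumes "algebra_morphism sU sV g"
  shows "(\<forall>n\<ge>1. \<forall>\<theta>\<in>C_As sU sV (n - 1). \<forall>\<theta>U \<theta>V \<theta>g. gs_tuple n \<theta> = (\<theta>U, \<theta>V, \<theta>g) \<longrightarrow>
            delta_GS sU sV g n (\<theta>U, \<theta>V, \<theta>g) =
              (fun_scale sU ((-1) ^ (n + 1)) (b_self sU n \<theta>U),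
               fun_scale sV ((-1) ^ (n + 1)) (b_self sV n \<theta>V),
               \<lambda>us. g (\<theta>U us) - \<theta>V (map g us) - sV ((-1) ^ n) (b_via sV g (n - 1) \<theta>g us)))
       \<and> cochain_complex 1 (As_scale sU sV) (\<lambda>n. C_As sU sV (n - 1)) (\<lambda>n. delta_As sU sV g)
       \<and> cochain_complex 1 (gs_scale sU sV) (C_GS sU sV) (d_GS sU sV g)
       \<and> cochain_map 1 (As_scale sU sV) (\<lambda>n. C_As sU sV (n - 1)) (\<lambda>n. delta_As sU sV g)
           (gs_scale sU sV) (C_GS sU sV) (d_GS sU sV g) (gs_iso sU sV)
       \<and> (\<forall>n\<ge>2. bij_betw (gs_tuple n) (C_As sU sV (n - 1)) (C_GS sU sV n))
       \<and> (\<forall>n\<ge>2. bij_betw (gs_iso sU sV n) (C_As sU sV (n - 1)) (C_GS sU sV n))"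
proof -
  interpret algebra_morphism sU sV g by fact
  have "delta_GS sU sV g n (\<theta>U, \<theta>V, \<theta>g) =
      (fun_scale sU ((-1) ^ (n + 1)) (b_self sU n \<theta>U), fun_scale sV ((-1) ^ (n + 1)) (b_self sV n \<theta>V),
       \<lambda>us. g (\<theta>U us) - \<theta>V (map g us) - sV ((-1) ^ n) (b_via sV g (n - 1) \<theta>g us))"
    if "n \<ge> 1" "\<theta> \<in> C_As sU sV (n - 1)" "gs_tuple n \<theta> = (\<theta>U, \<theta>V, \<theta>g)" for n \<theta> \<theta>U \<theta>V \<theta>g
    using delta_GS_tuple[OF that(1,2)] unfolding that(3) gs_delta_def by simp
  then show ?thesis
    using cochain_complex_As cochain_complex_GS cochain_map_gs_iso bij_gs_tuple bij_gs_iso by blast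
qed

end
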